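(* Let $\mathbb{F}$ be an algebraically closed field of characteristic zero and let $(\mathfrak{g},[\cdot,\cdot],B)$ be a finite-dimensional, indecomposable, non-simple quadratic Lie super algebra over $\mathbb{F}$ of degree $\delta\in\mathbb{Z}_2$, with $\dim(\mathfrak{g})>1$. Then $(\mathfrak{g},[\cdot,\cdot],B)$ is a generalized double extension of degree $\delta$ of a quadratic Lie super algebra $(\mathfrak{h},[\cdot,\cdot]_{\mathfrak h},B_{\mathfrak h})$ of degree $\delta$ by a Lie super algebra $(\mathfrak{a},[\cdot,\cdot]_{\mathfrak a})$.
   Context: A super-space is a $\mathbb{Z}_2$-graded vector space $V=V_0\oplus V_1$ over $\mathbb{F}$; $|u|\in\mathbb{Z}_2$ denotes the degree of a homogeneous element (or homogeneous map) $u$; $\mathbb{F}$ has the trivial grading; $\dim V=\dim V_0+\dim V_1$. All formulas are written for homogeneous elements and extended linearly. "Even" means homogeneous of degree $0$. Lie super algebra: a super-space $\mathfrak{g}$ with a bilinear map $[\cdot,\cdot]$ such that $[\mathfrak{g}_\eta,\mathfrak{g}_\zeta]\subseteq\mathfrak{g}_{\eta+\zeta}$, $[x,y]=-(-1)^{|x||y|}[y,x]$ (super skew-symmetry) and $\sum_{\text{cyclic}}(-1)^{|x||z|}[x,[y,z]]=0$, where $\sum_{\text{cyclic}}(-1)^{|x||z|}F(x,y,z)$ means $(-1)^{|x||z|}F(x,y,z)+(-1)^{|y||x|}F(y,z,x)+(-1)^{|z||y|}F(z,x,y)$. An ideal is a graded subspace $I$ with $[\mathfrak{g},I]\subset I$.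 Quadratic Lie super algebra of degree $\delta$: a triple $(\mathfrak{g},[\cdot,\cdot],B)$ with $(\mathfrak{g},[\cdot,\cdot])$ a Lie super algebra and $B:\mathfrak{g}\times\mathfrak{g}\to\mathbb{F}$ an invariant metric with $|B|=\delta$, i.e. a bilinear form that is non-degenerate, super-symmetric ($B(x,y)=(-1)^{|x||y|}B(y,x)$), invariant ($B([x,y],z)=B(x,[y,z])$) and homogeneous of degree $\delta$: even ($|B|=0$) if $B(\mathfrak{g}_0,\mathfrak{g}_1)=B(\mathfrak{g}_1,\mathfrak{g}_0)=\{0\}$, odd ($|B|=1$) if $B(\mathfrak{g}_\eta,\mathfrak{g}_\eta)=\{0\}$ for all $\eta\in\mathbb{Z}_2$. It is decomposable if there is a non-zero ideal $I\neq\mathfrak{g}$ with $\mathfrak{g}=I\oplus I^\perp$, and indecomposable otherwise. $\operatorname{Der}(\mathfrak{h})$ is the super-space spanned by homogeneous derivations, i.e. homogeneous linear maps $D$ with $D([x,y])=[D(x),y]+(-1)^{|D||x|}[x,D(y)]$; $\mathfrak{o}(B_{\mathfrak h})$ is the super-space spanned by homogeneous linear maps $D$ with $B_{\mathfrak h}(D(x),y)=-(-1)^{|x||D|}B_{\mathfrak h}(x,D(y))$. $[\cdot,\cdot]_{\mathfrak{gl}(\mathfrak h)}$ is the super commutator and $\operatorname{ad}_{\mathfrak h}(u)=[u,\cdot]_{\mathfrak h}$. Change of parity: $\mathbf{P}(V)$ is $V$ with grading $\mathbf{P}(V)_0=V_1$, $\mathbf{P}(V)_1=V_0$; $\mathbf{P}_0(V)=V$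 and $\mathbf{P}_1(V)=\mathbf{P}(V)$. The element of $\mathbf{P}_\delta(V)$ corresponding to $v\in V$ is $P_\delta(v)$, with $|P_\delta(v)|=|v|+\delta$. One identifies $\mathbf{P}_\delta(V^* )=\mathbf{P}_\delta(V)^*$ via $P_\delta(f)(P_\delta(v))=f(v)$. The $\delta$-coadjoint representation $\operatorname{ad}_\delta^*:\mathfrak{a}\to\mathfrak{gl}(\mathbf{P}_\delta(\mathfrak{a})^* )$ is $\operatorname{ad}_\delta^*(x)(P_\delta(f))(P_\delta(y))=-(-1)^{(|f|+\delta)|x|}f([x,y]_{\mathfrak a})$ for $x,y\in\mathfrak{a}$, $f\in\mathfrak{a}^*$. A $\delta$-context of generalized double extension of a quadratic Lie super algebra $(\mathfrak{h},[\cdot,\cdot]_{\mathfrak h},B_{\mathfrak h})$ of degree $\delta$ by a Lie super algebra $(\mathfrak{a},[\cdot,\cdot]_{\mathfrak a})$ is a tuple $(\mathfrak{h},[\cdot,\cdot]_{\mathfrak h},B_{\mathfrak h},\rho,\lambda,\omega_\delta)$, where $\rho:\mathfrak{a}\to\operatorname{Der}(\mathfrak{h})\cap\mathfrak{o}(B_{\mathfrak h})$ is an even linear map, $\lambda:\mathfrak{a}\times\mathfrak{a}\to\mathfrak{h}$ is an even super skew-symmetric bilinear map, $\omega_\delta:\mathfrak{a}\times\mathfrak{a}\to\mathbf{P}_\delta(\mathfrak{a})^*$ is an even super skew-symmetric bilinear map, and for all $x,y,z\in\mathfrak{a}$: (1) $[\rho(x),\rho(y)]_{\mathfrak{gl}(\mathfrak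 h)}-\rho([x,y]_{\mathfrak a})=\operatorname{ad}_{\mathfrak h}(\lambda(x,y))$; (2) $\sum_{\text{cyclic}}(-1)^{|z||x|}\big(\rho(x)(\lambda(y,z))+\lambda(x,[y,z]_{\mathfrak a})\big)=0$; (3) $\sum_{\text{cyclic}}(-1)^{|z||x|}\big(\operatorname{ad}_\delta^*(x)(\omega_\delta(y,z))+\omega_\delta(x,[y,z]_{\mathfrak a})+\chi_\delta(x,\lambda(y,z))\big)=0$, where $\chi_\delta:\mathfrak{a}\times\mathfrak{h}\to\mathbf{P}_\delta(\mathfrak{a})^*$ is the even bilinear map $\chi_\delta(x,u)(P_\delta(y))=-(-1)^{|u||y|}B_{\mathfrak h}(\lambda(x,y),u)$; (4) $\omega_\delta(x,y)(P_\delta(z))=(-1)^{(|y|+|z|)|x|}\omega_\delta(y,z)(P_\delta(x))$. Given such a context, let $\Phi_\delta:\mathfrak{h}\times\mathfrak{h}\to\mathbf{P}_\delta(\mathfrak{a})^*$ be the even super skew-symmetric bilinear map $\Phi_\delta(u,v)(P_\delta(x))=(-1)^{|x|(|u|+|v|)}B_{\mathfrak h}(\rho(x)(u),v)$. The generalized double extension of degree $\delta$ determined by the context is the quadratic Lie super algebra of degree $\delta$ on the super-space $\mathfrak{a}\oplus\mathfrak{h}\oplus\mathbf{P}_\delta(\mathfrak{a})^*$ whose super skew-symmetric bracket is given, for $x,y\in\mathfrak{a}$, $u,v\in\mathfrak{h}$, $\alpha\in\mathfrak{a}^*$, by $[x,y]=[x,y]_{\mathfrak a}+\lambda(x,y)+\omega_\delta(x,y)$,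 $[x,u]=\rho(x)(u)+\chi_\delta(x,u)$, $[u,v]=[u,v]_{\mathfrak h}+\Phi_\delta(u,v)$, $[x,P_\delta(\alpha)]=\operatorname{ad}_\delta^*(x)(P_\delta(\alpha))$, with $\mathfrak{h}$ and $\mathbf{P}_\delta(\mathfrak{a})^*$ commuting and $\mathbf{P}_\delta(\mathfrak{a})^*$ abelian, and whose invariant metric is, on homogeneous elements, $(x+u+P_\delta(\alpha),\,y+v+P_\delta(\beta))\mapsto(-1)^{|x||P_\delta(\beta)|}\beta(x)+B_{\mathfrak h}(u,v)+\alpha(y)$. Saying that $(\mathfrak{g},[\cdot,\cdot],B)$ "is a generalized double extension of degree $\delta$" of $\mathfrak{h}$ by $\mathfrak{a}$ means that it is isometric (via an even isomorphism of Lie super algebras preserving the invariant metrics) to the generalized double extension determined by some $\delta$-context of $\mathfrak{h}$ by $\mathfrak{a}$. *)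

theory Defs
  imports
    "HOL-Library.Z2"
    "HOL-Library.Function_Algebras"
    "HOL-Library.Product_Plus"
    "HOL-Computational_Algebra.Computational_Algebra"
begin

section \<open>Super-spaces\<close>

text \<open>
  A super-space is given by its two homogeneous parts \<open>V 0\<close> and \<open>V 1\<close>, which are subspaces of an
  ambient vector space with scalar multiplication \<open>s\<close>; the space itself is \<open>carr V\<close>. Degrees live
  in the two-element field \<^typ>\<open>bit\<close>. All maps are total HOL functions of which only the values on
  the carriers are relevant.
\<close>

definition carr :: "(bit \<Rightarrow> 'v::ab_group_add set) \<Rightarrow> 'v set" where
  "carr V = {u + v | u v. u \<in> V 0 \<and> v \<in> V 1}"

locale super_space = vector_space s
  for s :: "'f::field \<Rightarrow> 'v::ab_group_add \<Rightarrow> 'v" +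
  fixes V :: "bit \<Rightarrow> 'v set"
  assumes subspace_part: "subspace (V d)"
    and parts_independent: "V 0 \<inter> V 1 = {0}"

definition psign :: "bit \<Rightarrow> 'f::ring_1" where
  "psign d = (if d = 0 then 1 else - 1)"

text \<open>\<open>hcomp V d x\<close> is the component of degree \<open>d\<close> of \<open>x \<in> carr V\<close>.\<close>

definition hcomp :: "(bit \<Rightarrow> 'v::ab_group_add set) \<Rightarrow> bit \<Rightarrow> 'v \<Rightarrow> 'v" where
  "hcomp V d x = (THE u. u \<in> V d \<and> x - u \<in> V (d + 1))"

text \<open>
  \<open>biext V W F\<close> extends bilinearly to \<open>carr V \<times> carr W\<close> a formula \<open>F d e x y\<close> that is given for
  homogeneous \<open>x \<in> V d\<close> and \<open>y \<in> W e\<close> and mentions the degrees \<open>d\<close> and \<open>e\<close>.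
\<close>

definition biext ::
  "(bit \<Rightarrow> 'v::ab_group_add set) \<Rightarrow> (bit \<Rightarrow> 'w::ab_group_add set) \<Rightarrow>
   (bit \<Rightarrow> bit \<Rightarrow> 'v \<Rightarrow> 'w \<Rightarrow> 'r::comm_monoid_add) \<Rightarrow> 'v \<Rightarrow> 'w \<Rightarrow> 'r" where
  "biext V W F x y = (\<Sum>d\<in>{0,1}. \<Sum>e\<in>{0,1}. F d e (hcomp V d x) (hcomp W e y))"

definition linear_map_on ::
  "('f \<Rightarrow> 'v::ab_group_add \<Rightarrow> 'v) \<Rightarrow> ('f \<Rightarrow> 'w::ab_group_add \<Rightarrow> 'w) \<Rightarrow> 'v set \<Rightarrow> ('v \<Rightarrow> 'w) \<Rightarrow> bool" where
  "linear_map_on s t S f \<longleftrightarrow>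
     (\<forall>x\<in>S. \<forall>y\<in>S. f (x + y) = f x + f y) \<and> (\<forall>c. \<forall>x\<in>S. f (s c x) = t c (f x))"

definition bilinear_map_on ::
  "('f \<Rightarrow> 'v::ab_group_add \<Rightarrow> 'v) \<Rightarrow> ('f \<Rightarrow> 'w::ab_group_add \<Rightarrow> 'w) \<Rightarrow>
   ('f \<Rightarrow> 'r::ab_group_add \<Rightarrow> 'r) \<Rightarrow> 'v set \<Rightarrow> 'w set \<Rightarrow> ('v \<Rightarrow> 'w \<Rightarrow> 'r) \<Rightarrow> bool" where
  "bilinear_map_on s t r S T f \<longleftrightarrow>
     (\<forall>x\<in>S. linear_map_on t r T (f x)) \<and> (\<forall>y\<in>T. linear_map_on s r S (\<lambda>x. f x y))"

definition even_bilinear_map ::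
  "('f \<Rightarrow> 'v::ab_group_add \<Rightarrow> 'v) \<Rightarrow> ('f \<Rightarrow> 'w::ab_group_add \<Rightarrow> 'w) \<Rightarrow>
   ('f \<Rightarrow> 'r::ab_group_add \<Rightarrow> 'r) \<Rightarrow> (bit \<Rightarrow> 'v set) \<Rightarrow> (bit \<Rightarrow> 'w set) \<Rightarrow> (bit \<Rightarrow> 'r set) \<Rightarrow>
   ('v \<Rightarrow> 'w \<Rightarrow> 'r) \<Rightarrow> bool" where
  "even_bilinear_map s t r V W R f \<longleftrightarrow>
     bilinear_map_on s t r (carr V) (carr W) f \<and>
     (\<forall>d e. \<forall>x\<in>V d. \<forall>y\<in>W e. f x y \<in> R (d + e))"

definition super_skew ::
  "('f::ring_1 \<Rightarrow> 'r::ab_group_add \<Rightarrow> 'r) \<Rightarrow> (bit \<Rightarrow> 'v set) \<Rightarrow> ('v \<Rightarrow> 'v \<Rightarrow> 'r) \<Rightarrow> bool" where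
  "super_skew r V f \<longleftrightarrow> (\<forall>d e. \<forall>x\<in>V d. \<forall>y\<in>V e. f x y = - r (psign (d * e)) (f y x))"

text \<open>Here \<open>d\<close>, \<open>e\<close>, \<open>f\<close> are the degrees of \<open>x\<close>, \<open>y\<close>, \<open>z\<close>.\<close>

definition cyclic_sum ::
  "('f::ring_1 \<Rightarrow> 'r::ab_group_add \<Rightarrow> 'r) \<Rightarrow> bit \<Rightarrow> bit \<Rightarrow> bit \<Rightarrow>
   ('v \<Rightarrow> 'v \<Rightarrow> 'v \<Rightarrow> 'r) \<Rightarrow> 'v \<Rightarrow> 'v \<Rightarrow> 'v \<Rightarrow> 'r" where
  "cyclic_sum r d e f F x y z =
     r (psign (d * f)) (F x y z) + r (psign (e * d)) (F y z x) + r (psign (f * e)) (F z x y)"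

definition graded_subspace ::
  "('f::field \<Rightarrow> 'v::ab_group_add \<Rightarrow> 'v) \<Rightarrow> (bit \<Rightarrow> 'v set) \<Rightarrow> 'v set \<Rightarrow> bool" where
  "graded_subspace s V I \<longleftrightarrow>
     module.subspace s I \<and> I \<subseteq> carr V \<and> (\<forall>x\<in>V 0. \<forall>y\<in>V 1. x + y \<in> I \<longrightarrow> x \<in> I \<and> y \<in> I)"


section \<open>Quadratic Lie super algebras\<close>

locale lie_superalgebra = super_space s L
  for s :: "'f::field \<Rightarrow> 'v::ab_group_add \<Rightarrow> 'v" and L :: "bit \<Rightarrow> 'v set" +
  fixes br :: "'v \<Rightarrow> 'v \<Rightarrow> 'v"
  assumes bracket_even_bilinear: "even_bilinear_map s s s L L L br"
    and bracket_skew: "super_skew s L br"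
    and jacobi: "x \<in> L d \<Longrightarrow> y \<in> L e \<Longrightarrow> z \<in> L f \<Longrightarrow>
      cyclic_sum s d e f (\<lambda>x y z. br x (br y z)) x y z = 0"

definition lie_ideal ::
  "('f::field \<Rightarrow> 'v::ab_group_add \<Rightarrow> 'v) \<Rightarrow> (bit \<Rightarrow> 'v set) \<Rightarrow> ('v \<Rightarrow> 'v \<Rightarrow> 'v) \<Rightarrow> 'v set \<Rightarrow> bool" where
  "lie_ideal s L br I \<longleftrightarrow>
     graded_subspace s L I \<and> (\<forall>x\<in>carr L. \<forall>y\<in>I. br x y \<in> I)"

definition simple_lie ::
  "('f::field \<Rightarrow> 'v::ab_group_add \<Rightarrow> 'v) \<Rightarrow> (bit \<Rightarrow> 'v set) \<Rightarrow> ('v \<Rightarrow> 'v \<Rightarrow> 'v) \<Rightarrow> bool" where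
  "simple_lie s L br \<longleftrightarrow>
     (\<exists>x\<in>carr L. \<exists>y\<in>carr L. br x y \<noteq> 0) \<and> (\<forall>I. lie_ideal s L br I \<longrightarrow> I = {0} \<or> I = carr L)"

locale quadratic_lie_superalgebra = lie_superalgebra s L br
  for s :: "'f::field \<Rightarrow> 'v::ab_group_add \<Rightarrow> 'v" and L :: "bit \<Rightarrow> 'v set"
    and br :: "'v \<Rightarrow> 'v \<Rightarrow> 'v" +
  fixes B :: "'v \<Rightarrow> 'v \<Rightarrow> 'f" and \<delta> :: bit
  assumes form_bilinear: "bilinear_map_on s s (*) (carr L) (carr L) B"
    and form_nondegenerate: "x \<in> carr L \<Longrightarrow> (\<forall>y\<in>carr L. B x y = 0) \<Longrightarrow> x = 0"
    and form_supersymmetric: "x \<in> L d \<Longrightarrow> y \<in> L e \<Longrightarrow> B x y = psign (d * e) * B y x"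
    and form_invariant: "x \<in> carr L \<Longrightarrow> y \<in> carr L \<Longrightarrow> z \<in> carr L \<Longrightarrow> B (br x y) z = B x (br y z)"
    and form_degree: "x \<in> L d \<Longrightarrow> y \<in> L e \<Longrightarrow> d + e \<noteq> \<delta> \<Longrightarrow> B x y = 0"

definition orthogonal_space ::
  "(bit \<Rightarrow> 'v::ab_group_add set) \<Rightarrow> ('v \<Rightarrow> 'v \<Rightarrow> 'f::zero) \<Rightarrow> 'v set \<Rightarrow> 'v set" where
  "orthogonal_space L B I = {x \<in> carr L. \<forall>y\<in>I. B x y = 0}"

definition decomposable ::
  "('f::field \<Rightarrow> 'v::ab_group_add \<Rightarrow> 'v) \<Rightarrow> (bit \<Rightarrow> 'v set) \<Rightarrow> ('v \<Rightarrow> 'v \<Rightarrow> 'v) \<Rightarrow>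
   ('v \<Rightarrow> 'v \<Rightarrow> 'f) \<Rightarrow> bool" where
  "decomposable s L br B \<longleftrightarrow>
     (\<exists>I. lie_ideal s L br I \<and> I \<noteq> {0} \<and> I \<noteq> carr L \<and>
        I \<inter> orthogonal_space L B I = {0} \<and>
        carr L = {x + y | x y. x \<in> I \<and> y \<in> orthogonal_space L B I})"

text \<open>Homogeneous linear endomorphisms of degree \<open>k\<close>, and the homogeneous parts of degree \<open>k\<close> of
  \<open>Der\<close> and of the orthogonal Lie super algebra of \<open>B\<close>.\<close>

definition hom_maps ::
  "('f \<Rightarrow> 'v::ab_group_add \<Rightarrow> 'v) \<Rightarrow> (bit \<Rightarrow> 'v set) \<Rightarrow> bit \<Rightarrow> ('v \<Rightarrow> 'v) set" where
  "hom_maps s V k = {D. linear_map_on s s (carr V) D \<and> (\<forall>d. \<forall>x\<in>V d. D x \<in> V (d + k))}"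

definition Der ::
  "('f::field \<Rightarrow> 'v::ab_group_add \<Rightarrow> 'v) \<Rightarrow> (bit \<Rightarrow> 'v set) \<Rightarrow> ('v \<Rightarrow> 'v \<Rightarrow> 'v) \<Rightarrow> bit \<Rightarrow> ('v \<Rightarrow> 'v) set" where
  "Der s L br k = {D \<in> hom_maps s L k.
     \<forall>d. \<forall>x\<in>L d. \<forall>y\<in>carr L. D (br x y) = br (D x) y + s (psign (k * d)) (br x (D y))}"

definition ortho ::
  "('f::field \<Rightarrow> 'v::ab_group_add \<Rightarrow> 'v) \<Rightarrow> (bit \<Rightarrow> 'v set) \<Rightarrow> ('v \<Rightarrow> 'v \<Rightarrow> 'f) \<Rightarrow> bit \<Rightarrow> ('v \<Rightarrow> 'v) set" where
  "ortho s L B k = {D \<in> hom_maps s L k.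
     \<forall>d. \<forall>x\<in>L d. \<forall>y\<in>carr L. B (D x) y = - (psign (d * k) * B x (D y))}"


section \<open>Change of parity and duals\<close>

text \<open>
  The change of parity does not alter the underlying space, so that the element of the shifted space
  corresponding to \<open>v\<close> is \<open>v\<close> itself. A linear functional on \<open>carr V\<close> is represented by a function
  vanishing outside of \<open>carr V\<close>. With \<open>f\<close> viewed as an element of the shifted dual \<open>pdual s \<delta> A\<close>, its
  degree \<open>e\<close> is the degree of \<open>f\<close> as functional on \<open>A\<close> plus \<open>\<delta>\<close>.
\<close>

definition parity_shift :: "bit \<Rightarrow> (bit \<Rightarrow> 'v set) \<Rightarrow> bit \<Rightarrow> 'v set" where
  "parity_shift \<delta> V d = V (d + \<delta>)"

definition dual ::
  "('f::field \<Rightarrow> 'v::ab_group_add \<Rightarrow> 'v) \<Rightarrow> (bit \<Rightarrow> 'v set) \<Rightarrow> bit \<Rightarrow> ('v \<Rightarrow> 'f) set" where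
  "dual s V d = {f. linear_map_on s (*) (carr V) f \<and> (\<forall>x. x \<notin> carr V \<longrightarrow> f x = 0) \<and>
     (\<forall>x\<in>V (d + 1). f x = 0)}"

definition pdual ::
  "('f::field \<Rightarrow> 'v::ab_group_add \<Rightarrow> 'v) \<Rightarrow> bit \<Rightarrow> (bit \<Rightarrow> 'v set) \<Rightarrow> bit \<Rightarrow> ('v \<Rightarrow> 'f) set" where
  "pdual s \<delta> A = dual s (parity_shift \<delta> A)"

definition fun_scale :: "'f::field \<Rightarrow> ('v \<Rightarrow> 'f) \<Rightarrow> 'v \<Rightarrow> 'f" where
  "fun_scale c f = (\<lambda>x. c * f x)"

definition coad ::
  "('f::field \<Rightarrow> 'a::ab_group_add \<Rightarrow> 'a) \<Rightarrow> bit \<Rightarrow> (bit \<Rightarrow> 'a set) \<Rightarrow> ('a \<Rightarrow> 'a \<Rightarrow> 'a) \<Rightarrow>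
   'a \<Rightarrow> ('a \<Rightarrow> 'f) \<Rightarrow> 'a \<Rightarrow> 'f" where
  "coad sa \<delta> A bra = biext A (pdual sa \<delta> A)
     (\<lambda>d e x f y. if y \<in> carr A then - (psign (e * d) * f (bra x y)) else 0)"


section \<open>Generalized double extensions\<close>

definition chi ::
  "(bit \<Rightarrow> 'a::ab_group_add set) \<Rightarrow> (bit \<Rightarrow> 'h::ab_group_add set) \<Rightarrow> ('h \<Rightarrow> 'h \<Rightarrow> 'f::field) \<Rightarrow>
   ('a \<Rightarrow> 'a \<Rightarrow> 'h) \<Rightarrow> 'a \<Rightarrow> 'h \<Rightarrow> 'a \<Rightarrow> 'f" where
  "chi A H Bh lam x u y =
     (if y \<in> carr A then biext H A (\<lambda>d e u y. - (psign (d * e) * Bh (lam x y) u)) u y else 0)"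

definition Phi ::
  "(bit \<Rightarrow> 'a::ab_group_add set) \<Rightarrow> (bit \<Rightarrow> 'h::ab_group_add set) \<Rightarrow> ('h \<Rightarrow> 'h \<Rightarrow> 'f::field) \<Rightarrow>
   ('a \<Rightarrow> 'h \<Rightarrow> 'h) \<Rightarrow> 'h \<Rightarrow> 'h \<Rightarrow> 'a \<Rightarrow> 'f" where
  "Phi A H Bh \<rho> u v x =
     (if x \<in> carr A
      then biext H H (\<lambda>d e u v. \<Sum>k\<in>{0,1}. psign (k * (d + e)) * Bh (\<rho> (hcomp A k x) u) v) u v
      else 0)"

text \<open>
  \<open>rho_even\<close> says that \<open>\<rho>\<close> is an even map into the intersection of the graded spaces \<open>Der\<close> and
  \<open>ortho\<close>: it maps \<open>A d\<close> to the homogeneous part of degree \<open>d\<close> of the intersection.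
\<close>

locale gde_context =
  h: quadratic_lie_superalgebra sh H brh Bh \<delta> + a: lie_superalgebra sa A bra
  for sh :: "'f::field \<Rightarrow> 'h::ab_group_add \<Rightarrow> 'h" and H brh Bh \<delta>
    and sa :: "'f \<Rightarrow> 'a::ab_group_add \<Rightarrow> 'a" and A bra +
  fixes \<rho> :: "'a \<Rightarrow> 'h \<Rightarrow> 'h" and lam :: "'a \<Rightarrow> 'a \<Rightarrow> 'h" and \<omega> :: "'a \<Rightarrow> 'a \<Rightarrow> 'a \<Rightarrow> 'f"
  assumes rho_linear: "u \<in> carr H \<Longrightarrow> linear_map_on sa sh (carr A) (\<lambda>x. \<rho> x u)"
    and rho_even: "x \<in> A d \<Longrightarrow> \<rho> x \<in> Der sh H brh d \<inter> ortho sh H Bh d"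
    and lam_even_bilinear: "even_bilinear_map sa sa sh A A H lam"
    and lam_skew: "super_skew sh A lam"
    and omega_even_bilinear: "even_bilinear_map sa sa fun_scale A A (pdual sa \<delta> A) \<omega>"
    and omega_skew: "super_skew fun_scale A \<omega>"
    and rho_bracket: "x \<in> A d \<Longrightarrow> y \<in> A e \<Longrightarrow> u \<in> carr H \<Longrightarrow>
      (\<rho> x (\<rho> y u) - sh (psign (d * e)) (\<rho> y (\<rho> x u))) - \<rho> (bra x y) u = brh (lam x y) u"
    and lam_cocycle: "x \<in> A d \<Longrightarrow> y \<in> A e \<Longrightarrow> z \<in> A f \<Longrightarrow>
      cyclic_sum sh d e f (\<lambda>x y z. \<rho> x (lam y z) + lam x (bra y z)) x y z = 0"
    and omega_cocycle: "x \<in> A d \<Longrightarrow> y \<in> A e \<Longrightarrow> z \<in> A f \<Longrightarrow>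
      cyclic_sum fun_scale d e f
        (\<lambda>x y z. coad sa \<delta> A bra x (\<omega> y z) + \<omega> x (bra y z) + chi A H Bh lam x (lam y z)) x y z = 0"
    and omega_cyclic: "x \<in> A d \<Longrightarrow> y \<in> A e \<Longrightarrow> z \<in> A f \<Longrightarrow>
      \<omega> x y z = psign ((e + f) * d) * \<omega> y z x"

definition gde_space ::
  "('f::field \<Rightarrow> 'a::ab_group_add \<Rightarrow> 'a) \<Rightarrow> bit \<Rightarrow> (bit \<Rightarrow> 'a set) \<Rightarrow> (bit \<Rightarrow> 'h set) \<Rightarrow>
   bit \<Rightarrow> ('a \<times> 'h \<times> ('a \<Rightarrow> 'f)) set" where
  "gde_space sa \<delta> A H d = A d \<times> H d \<times> pdual sa \<delta> A d"

definition gde_scale ::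
  "('f::field \<Rightarrow> 'a \<Rightarrow> 'a) \<Rightarrow> ('f \<Rightarrow> 'h \<Rightarrow> 'h) \<Rightarrow>
   'f \<Rightarrow> 'a \<times> 'h \<times> ('a \<Rightarrow> 'f) \<Rightarrow> 'a \<times> 'h \<times> ('a \<Rightarrow> 'f)" where
  "gde_scale sa sh c = (\<lambda>(x, u, f). (sa c x, sh c u, fun_scale c f))"

text \<open>
  The terms with \<open>biext\<close> are the brackets \<open>[u, y]\<close>, respectively \<open>[f, y]\<close>, which super skew-symmetry
  forces to be \<open>- (-1)\<^bsup>|u||y|\<^esup> [y, u]\<close> and \<open>- (-1)\<^bsup>|f||y|\<^esup> [y, f]\<close>.
\<close>

definition gde_bracket ::
  "('f::field \<Rightarrow> 'h::ab_group_add \<Rightarrow> 'h) \<Rightarrow> (bit \<Rightarrow> 'h set) \<Rightarrow> ('h \<Rightarrow> 'h \<Rightarrow> 'h) \<Rightarrow> ('h \<Rightarrow> 'h \<Rightarrow> 'f) \<Rightarrow> bit \<Rightarrow>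
   ('f \<Rightarrow> 'a::ab_group_add \<Rightarrow> 'a) \<Rightarrow> (bit \<Rightarrow> 'a set) \<Rightarrow> ('a \<Rightarrow> 'a \<Rightarrow> 'a) \<Rightarrow>
   ('a \<Rightarrow> 'h \<Rightarrow> 'h) \<Rightarrow> ('a \<Rightarrow> 'a \<Rightarrow> 'h) \<Rightarrow> ('a \<Rightarrow> 'a \<Rightarrow> 'a \<Rightarrow> 'f) \<Rightarrow>
   'a \<times> 'h \<times> ('a \<Rightarrow> 'f) \<Rightarrow> 'a \<times> 'h \<times> ('a \<Rightarrow> 'f) \<Rightarrow> 'a \<times> 'h \<times> ('a \<Rightarrow> 'f)" where
  "gde_bracket sh H brh Bh \<delta> sa A bra \<rho> lam \<omega> = (\<lambda>(x, u, f) (y, v, g).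
     (bra x y,
      lam x y + \<rho> x v - biext H A (\<lambda>d e u y. sh (psign (d * e)) (\<rho> y u)) u y + brh u v,
      \<omega> x y
      + chi A H Bh lam x v
      - biext H A (\<lambda>d e u y. fun_scale (psign (d * e)) (chi A H Bh lam y u)) u y
      + Phi A H Bh \<rho> u v
      + coad sa \<delta> A bra x g
      - biext (pdual sa \<delta> A) A (\<lambda>d e f y. fun_scale (psign (d * e)) (coad sa \<delta> A bra y f)) f y))"

definition gde_form ::
  "('h \<Rightarrow> 'h \<Rightarrow> 'f::field) \<Rightarrow> bit \<Rightarrow> ('f \<Rightarrow> 'a::ab_group_add \<Rightarrow> 'a) \<Rightarrow> (bit \<Rightarrow> 'a set) \<Rightarrow>
   'a \<times> 'h \<times> ('a \<Rightarrow> 'f) \<Rightarrow> 'a \<times> 'h \<times> ('a \<Rightarrow> 'f) \<Rightarrow> 'f" where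
  "gde_form Bh \<delta> sa A = (\<lambda>(x, u, f) (y, v, g).
     biext A (pdual sa \<delta> A) (\<lambda>d e x g. psign (d * e) * g x) x g + Bh u v + f y)"

definition isometry ::
  "('f::field \<Rightarrow> 'v::ab_group_add \<Rightarrow> 'v) \<Rightarrow> (bit \<Rightarrow> 'v set) \<Rightarrow> ('v \<Rightarrow> 'v \<Rightarrow> 'v) \<Rightarrow> ('v \<Rightarrow> 'v \<Rightarrow> 'f) \<Rightarrow>
   ('f \<Rightarrow> 'w::ab_group_add \<Rightarrow> 'w) \<Rightarrow> (bit \<Rightarrow> 'w set) \<Rightarrow> ('w \<Rightarrow> 'w \<Rightarrow> 'w) \<Rightarrow> ('w \<Rightarrow> 'w \<Rightarrow> 'f) \<Rightarrow>
   ('v \<Rightarrow> 'w) \<Rightarrow> bool" where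
  "isometry s G br B s' G' br' B' \<phi> \<longleftrightarrow>
     linear_map_on s s' (carr G) \<phi> \<and> bij_betw \<phi> (carr G) (carr G') \<and>
     (\<forall>d. \<forall>x\<in>G d. \<phi> x \<in> G' d) \<and>
     (\<forall>x\<in>carr G. \<forall>y\<in>carr G. \<phi> (br x y) = br' (\<phi> x) (\<phi> y)) \<and>
     (\<forall>x\<in>carr G. \<forall>y\<in>carr G. B' (\<phi> x) (\<phi> y) = B x y)"

definition is_generalized_double_extension ::
  "('f::field \<Rightarrow> 'v::ab_group_add \<Rightarrow> 'v) \<Rightarrow> (bit \<Rightarrow> 'v set) \<Rightarrow> ('v \<Rightarrow> 'v \<Rightarrow> 'v) \<Rightarrow> ('v \<Rightarrow> 'v \<Rightarrow> 'f) \<Rightarrow> bit \<Rightarrow>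
   ('f \<Rightarrow> 'h::ab_group_add \<Rightarrow> 'h) \<Rightarrow> (bit \<Rightarrow> 'h set) \<Rightarrow> ('h \<Rightarrow> 'h \<Rightarrow> 'h) \<Rightarrow> ('h \<Rightarrow> 'h \<Rightarrow> 'f) \<Rightarrow>
   ('f \<Rightarrow> 'a::ab_group_add \<Rightarrow> 'a) \<Rightarrow> (bit \<Rightarrow> 'a set) \<Rightarrow> ('a \<Rightarrow> 'a \<Rightarrow> 'a) \<Rightarrow> bool" where
  "is_generalized_double_extension s G br B \<delta> sh H brh Bh sa A bra \<longleftrightarrow>
     (\<exists>\<rho> lam \<omega> \<phi>. gde_context sh H brh Bh \<delta> sa A bra \<rho> lam \<omega> \<and>
        isometry s G br B
          (gde_scale sa sh) (gde_space sa \<delta> A H)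
          (gde_bracket sh H brh Bh \<delta> sa A bra \<rho> lam \<omega>) (gde_form Bh \<delta> sa A) \<phi>)"


section \<open>The formulas on homogeneous elements\<close>

lemma bit_cases: "(d::bit) = 0 \<or> d = 1"
  by (cases d) auto

lemma (in super_space) zero_part: "0 \<in> V d"
  using subspace_part subspace_0 by blast

lemma (in super_space) parts_zero: "x \<in> V d \<Longrightarrow> x \<in> V (d + 1) \<Longrightarrow> x = 0"
  using parts_independent by (cases d) auto

lemma (in super_space) part_carr:
  assumes "x \<in> V d"
  shows "x \<in> carr V"
proof (cases "d = 0")
  case True
  then have "x = x + 0 \<and> x \<in> V 0 \<and> 0 \<in> V 1" using assms zero_part by simp
  then show ?thesis unfolding carr_def by blast
next
  case False
  then have "x = 0 + x \<and> 0 \<in> V 0 \<and> x \<in> V 1" using assms zero_part by simp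
  then show ?thesis unfolding carr_def by blast
qed

lemma (in super_space) carr_add: "x \<in> carr V \<Longrightarrow> y \<in> carr V \<Longrightarrow> x + y \<in> carr V"
proof -
  assume "x \<in> carr V" "y \<in> carr V"
  then obtain a b c d where "a \<in> V 0" "b \<in> V 1" "c \<in> V 0" "d \<in> V 1" "x = a + b" "y = c + d"
    by (auto simp: carr_def)
  moreover have "a + c \<in> V 0" "b + d \<in> V 1"
    using calculation subspace_part subspace_add by blast+
  moreover have "x + y = (a + c) + (b + d)" using calculation by (simp add: algebra_simps)
  ultimately show ?thesis unfolding carr_def by blast
qed

lemma (in super_space) hcomp_unique:
  assumes "u \<in> V d" and "x - u \<in> V (d + 1)"
  shows "hcomp V d x = u"
  unfolding hcomp_def
proof (rule the_equality)
  show "u \<in> V d \<and> x - u \<in> V (d + 1)" using assms by blast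
  fix w assume w: "w \<in> V d \<and> x - w \<in> V (d + 1)"
  have "w - u \<in> V d" using w assms subspace_part subspace_diff by blast
  moreover have "(x - u) - (x - w) \<in> V (d + 1)" using w assms subspace_part subspace_diff by blast
  ultimately show "w = u" using parts_zero[of "w - u" d] by simp
qed

lemma (in super_space) hcomp_homogeneous:
  assumes "x \<in> V d"
  shows "hcomp V e x = (if e = d then x else 0)"
proof (cases "e = d")
  case True
  then show ?thesis using assms zero_part hcomp_unique[of x d x] by simp
next
  case False
  then have "e + 1 = d" by (cases d; cases e) simp_all
  then show ?thesis using False assms zero_part hcomp_unique[of 0 e x] by simp
qed

lemma (in super_space) hcomp_part:
  assumes "x \<in> carr V"
  shows "hcomp V d x \<in> V d"
proof -
  obtain a b where x: "x = a + b" and a: "a \<in> V 0" and b: "b \<in> V 1"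
    using assms unfolding carr_def by blast
  have "hcomp V 0 x = a" using a b by (intro hcomp_unique) (simp_all add: x)
  moreover have "hcomp V 1 x = b" using a b by (intro hcomp_unique) (simp_all add: x)
  ultimately show ?thesis using a b by (cases d) simp_all
qed

lemma biext_homogeneous:
  assumes "super_space s V" and "super_space t W" and "x \<in> V d" and "y \<in> W e"
    and "\<And>d e y. y \<in> carr W \<Longrightarrow> F d e 0 y = 0" and "\<And>d e x. x \<in> carr V \<Longrightarrow> F d e x 0 = 0"
  shows "biext V W F x y = F d e x y"
proof -
  interpret V: super_space s V by fact
  interpret W: super_space t W by fact
  have "F d' e' (if d' = d then x else 0) (if e' = e then y else 0) =
      (if d' = d \<and> e' = e then F d e x y else 0)" for d' e'
    using assms V.part_carr W.part_carr V.zero_part W.zero_part by auto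
  then show ?thesis
    using bit_cases[of d] bit_cases[of e]
    by (auto simp: biext_def V.hcomp_homogeneous[OF assms(3)] W.hcomp_homogeneous[OF assms(4)])
qed

lemma super_space_pdual:
  assumes "super_space s V"
  shows "super_space fun_scale (pdual s \<delta> V)"
proof -
  interpret V: super_space s V by fact
  interpret D: vector_space "fun_scale :: 'a \<Rightarrow> ('b \<Rightarrow> 'a) \<Rightarrow> _"
    by unfold_locales (auto simp: fun_scale_def algebra_simps fun_eq_iff)
  have carr: "carr (parity_shift \<delta> V) = carr V"
    using bit_cases[of \<delta>] by (auto simp: carr_def parity_shift_def) (metis add.commute)+
  show ?thesis
  proof
    show "D.subspace (pdual s \<delta> V d)" for d
      by (rule D.subspaceI)
        (auto simp: pdual_def dual_def linear_map_on_def fun_scale_def algebra_simps)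
    have "f = 0" if "f \<in> pdual s \<delta> V 0" and "f \<in> pdual s \<delta> V 1" for f
    proof
      fix x
      have f: "linear_map_on s (*) (carr V) f" "\<And>x. x \<notin> carr V \<Longrightarrow> f x = 0"
        using that carr by (auto simp: pdual_def dual_def)
      have "\<forall>u\<in>V (1 + \<delta>). f u = 0" "\<forall>u\<in>V \<delta>. f u = 0"
        using that by (cases \<delta>; auto simp: pdual_def dual_def parity_shift_def)+
      then have f0: "f u = 0" if "u \<in> V d" for u d
        using that by (cases d; cases \<delta>) auto
      show "f x = 0 x"
      proof (cases "x \<in> carr V")
        case True
        then obtain u v where "u \<in> V 0" "v \<in> V 1" "x = u + v" by (auto simp: carr_def)
        then show ?thesis using f(1) f0 V.part_carr by (auto simp: linear_map_on_def)
      qed (simp add: f)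
    qed
    then show "pdual s \<delta> V 0 \<inter> pdual s \<delta> V 1 = {0}"
      using D.subspace_0[OF \<open>\<And>d. D.subspace (pdual s \<delta> V d)\<close>] by auto
  qed
qed

lemma bilinear_map_on_zero:
  assumes "bilinear_map_on s t r S T f" and "x \<in> S" and "y \<in> T"
  shows "0 \<in> T \<Longrightarrow> f x 0 = 0" and "0 \<in> S \<Longrightarrow> f 0 y = 0"
proof -
  assume "0 \<in> T"
  then have "f x (0 + 0) = f x 0 + f x 0"
    using assms unfolding bilinear_map_on_def linear_map_on_def by blast
  then show "f x 0 = 0" by simp
next
  assume "0 \<in> S"
  then have "f (0 + 0) y = f 0 y + f 0 y"
    using assms unfolding bilinear_map_on_def linear_map_on_def by blast
  then show "f 0 y = 0" by simp
qed


context gde_context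
begin

sublocale p: super_space fun_scale "pdual sa \<delta> A"
  by (rule super_space_pdual) (rule a.super_space_axioms)

lemma zero_carr: "0 \<in> carr A" "0 \<in> carr H" "0 \<in> carr (pdual sa \<delta> A)"
  using a.zero_part a.part_carr h.zero_part h.part_carr p.zero_part p.part_carr by blast+

lemma bra_zero: "x \<in> carr A \<Longrightarrow> bra x 0 = 0" "x \<in> carr A \<Longrightarrow> bra 0 x = 0"
  using a.bracket_even_bilinear bilinear_map_on_zero zero_carr unfolding even_bilinear_map_def
  by blast+

lemma brh_zero: "x \<in> carr H \<Longrightarrow> brh x 0 = 0" "x \<in> carr H \<Longrightarrow> brh 0 x = 0"
  using h.bracket_even_bilinear bilinear_map_on_zero zero_carr unfolding even_bilinear_map_def
  by blast+

lemma lam_zero: "x \<in> carr A \<Longrightarrow> lam x 0 = 0" "x \<in> carr A \<Longrightarrow> lam 0 x = 0"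
  using lam_even_bilinear bilinear_map_on_zero zero_carr unfolding even_bilinear_map_def
  by blast+

lemma omega_zero: "x \<in> carr A \<Longrightarrow> \<omega> x 0 = 0" "x \<in> carr A \<Longrightarrow> \<omega> 0 x = 0"
  using omega_even_bilinear bilinear_map_on_zero zero_carr unfolding even_bilinear_map_def
  by blast+

lemma Bh_zero: "x \<in> carr H \<Longrightarrow> Bh x 0 = 0" "x \<in> carr H \<Longrightarrow> Bh 0 x = 0"
  using h.form_bilinear bilinear_map_on_zero zero_carr by blast+

lemma lam_carr: assumes x: "x \<in> carr A" and y: "y \<in> carr A" shows "lam x y \<in> carr H"
proof -
  obtain x0 x1 where x': "x0 \<in> A 0" "x1 \<in> A 1" "x = x0 + x1" using x by (auto simp: carr_def)
  obtain y0 y1 where y': "y0 \<in> A 0" "y1 \<in> A 1" "y = y0 + y1" using y by (auto simp: carr_def)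
  note c = a.part_carr[OF x'(1)] a.part_carr[OF x'(2)] a.part_carr[OF y'(1)] a.part_carr[OF y'(2)]
  have hom: "lam u v \<in> carr H" if "u \<in> A d" "v \<in> A e" for u v d e
    using lam_even_bilinear h.part_carr that unfolding even_bilinear_map_def by blast
  have b: "bilinear_map_on sa sa sh (carr A) (carr A) lam"
    using lam_even_bilinear unfolding even_bilinear_map_def by blast
  have "lam x y = lam x0 y + lam x1 y"
    using b c y unfolding x'(3) bilinear_map_on_def linear_map_on_def by blast
  also have "lam x0 y = lam x0 y0 + lam x0 y1"
    using b c unfolding y'(3) bilinear_map_on_def linear_map_on_def by blast
  also have "lam x1 y = lam x1 y0 + lam x1 y1"
    using b c unfolding y'(3) bilinear_map_on_def linear_map_on_def by blast
  finally show ?thesis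
    by (simp only:) (intro h.carr_add hom[OF x'(1) y'(1)] hom[OF x'(1) y'(2)]
        hom[OF x'(2) y'(1)] hom[OF x'(2) y'(2)])
qed

lemma rho_zero:
  shows "x \<in> A d \<Longrightarrow> \<rho> x 0 = 0" "u \<in> carr H \<Longrightarrow> \<rho> 0 u = 0"
proof -
  assume "x \<in> A d"
  then have "linear_map_on sh sh (carr H) (\<rho> x)"
    using rho_even unfolding Der_def hom_maps_def by blast
  then have "\<rho> x (0 + 0) = \<rho> x 0 + \<rho> x 0"
    using zero_carr unfolding linear_map_on_def by blast
  then show "\<rho> x 0 = 0" by simp
next
  assume "u \<in> carr H"
  then have "\<rho> (0 + 0) u = \<rho> 0 u + \<rho> 0 u"
    using zero_carr rho_linear unfolding linear_map_on_def by blast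
  then show "\<rho> 0 u = 0" by simp
qed

lemma rho_carr:
  assumes x: "x \<in> A k" and w: "w \<in> carr H"
  shows "\<rho> x w \<in> carr H"
proof -
  obtain w0 w1 where ww: "w0 \<in> H 0" "w1 \<in> H 1" "w = w0 + w1" using w by (auto simp: carr_def)
  have m: "\<rho> x \<in> hom_maps sh H k"
    using rho_even[OF x] unfolding Der_def by blast
  then have "\<rho> x w = \<rho> x w0 + \<rho> x w1"
    using ww h.part_carr unfolding hom_maps_def linear_map_on_def by blast
  moreover have "\<rho> x w0 \<in> H (0 + k)" "\<rho> x w1 \<in> H (1 + k)"
    using m ww unfolding hom_maps_def by blast+
  ultimately show ?thesis
    using h.carr_add h.part_carr by metis
qed

lemma functional_zero: "f \<in> carr (pdual sa \<delta> A) \<Longrightarrow> f 0 = 0"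
proof -
  assume "f \<in> carr (pdual sa \<delta> A)"
  then obtain k l where kl: "k \<in> pdual sa \<delta> A 0" "l \<in> pdual sa \<delta> A 1" "f = k + l"
    by (auto simp: carr_def)
  have "m 0 = 0" if "m \<in> pdual sa \<delta> A i" for m i
    using that a.zero_part by (auto simp: pdual_def dual_def parity_shift_def)
  from this[OF kl(1)] this[OF kl(2)] kl(3) show ?thesis by simp
qed

lemma coad_homogeneous:
  assumes "x \<in> A d" and "f \<in> pdual sa \<delta> A e" and "y \<in> carr A"
  shows "coad sa \<delta> A bra x f y = - (psign (e * d) * f (bra x y))"
  unfolding coad_def
  by (subst biext_homogeneous[OF a.super_space_axioms p.super_space_axioms assms(1,2)])
    (auto simp: bra_zero functional_zero assms(3) fun_eq_iff)

lemma chi_homogeneous: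
  assumes "x \<in> carr A" and "u \<in> H d" and "y \<in> A e"
  shows "chi A H Bh lam x u y = - (psign (d * e) * Bh (lam x y) u)"
  unfolding chi_def
  by (subst biext_homogeneous[OF h.super_space_axioms a.super_space_axioms assms(2,3)])
    (auto simp: lam_carr lam_zero Bh_zero assms(1) a.part_carr[OF assms(3)])

lemma Phi_homogeneous:
  assumes "u \<in> H d" and "v \<in> H e" and "x \<in> A k"
  shows "Phi A H Bh \<rho> u v x = psign (k * (d + e)) * Bh (\<rho> x u) v"
proof -
  have comp: "hcomp A i x \<in> A i" for i
    using a.hcomp_part[OF a.part_carr[OF assms(3)]] .
  have F: "(\<Sum>i\<in>{0,1}. psign (i * (d + e)) * Bh (\<rho> (hcomp A i x) u) v) =
      psign (k * (d + e)) * Bh (\<rho> x u) v"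
    using a.hcomp_homogeneous[OF assms(3)] bit_cases[of k] rho_zero(2)[OF h.part_carr[OF assms(1)]]
      Bh_zero(2)[OF h.part_carr[OF assms(2)]] by auto
  let ?F = "\<lambda>d e u v. \<Sum>i\<in>{0,1}. psign (i * (d + e)) * Bh (\<rho> (hcomp A i x) u) v"
  have "biext H H ?F u v = ?F d e u v"
  proof (rule biext_homogeneous[OF h.super_space_axioms h.super_space_axioms assms(1,2)])
    show "?F d e 0 w = 0" if "w \<in> carr H" for d e w
      by (rule sum.neutral) (simp add: rho_zero(1)[OF comp] Bh_zero(2)[OF that])
    show "?F d e w 0 = 0" if "w \<in> carr H" for d e w
      by (rule sum.neutral) (simp add: Bh_zero(1)[OF rho_carr[OF comp that]])
  qed
  then show ?thesis
    unfolding Phi_def if_P[OF a.part_carr[OF assms(3)]] F .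
qed

abbreviation bracket where "bracket \<equiv> gde_bracket sh H brh Bh \<delta> sa A bra \<rho> lam \<omega>"

lemma zero_maps:
  shows "x \<in> carr A \<Longrightarrow> chi A H Bh lam x 0 = 0" and "u \<in> carr H \<Longrightarrow> chi A H Bh lam 0 u = 0"
    and "v \<in> carr H \<Longrightarrow> Phi A H Bh \<rho> 0 v = 0" and "u \<in> carr H \<Longrightarrow> Phi A H Bh \<rho> u 0 = 0"
    and "x \<in> carr A \<Longrightarrow> coad sa \<delta> A bra x 0 = 0"
    and "f \<in> carr (pdual sa \<delta> A) \<Longrightarrow> coad sa \<delta> A bra 0 f = 0"
proof -
  have [simp]: "hcomp A d 0 = 0" "hcomp H d 0 = 0" "hcomp (pdual sa \<delta> A) d 0 = 0" for d
    using a.hcomp_homogeneous[OF a.zero_part[of 0]] h.hcomp_homogeneous[OF h.zero_part[of 0]]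
      p.hcomp_homogeneous[OF p.zero_part[of 0]] by simp_all
  have [simp]: "hcomp A d y \<in> carr A" if "y \<in> carr A" for y d
    by (rule a.part_carr[OF a.hcomp_part[OF that]])
  have [simp]: "hcomp H d y \<in> carr H" if "y \<in> carr H" for y d
    by (rule h.part_carr[OF h.hcomp_part[OF that]])
  have [simp]: "hcomp (pdual sa \<delta> A) d y \<in> carr (pdual sa \<delta> A)"
    if "y \<in> carr (pdual sa \<delta> A)" for y d
    by (rule p.part_carr[OF p.hcomp_part[OF that]])
  have [simp]: "\<rho> (hcomp A d y) 0 = 0" if "y \<in> carr A" for y d
    by (rule rho_zero(1)[OF a.hcomp_part[OF that]])
  have [simp]: "\<rho> (hcomp A d y) u \<in> carr H" if "y \<in> carr A" "u \<in> carr H" for y d u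
    by (rule rho_carr[OF a.hcomp_part[OF that(1)] that(2)])
  show "x \<in> carr A \<Longrightarrow> chi A H Bh lam x 0 = 0" "u \<in> carr H \<Longrightarrow> chi A H Bh lam 0 u = 0"
    by (auto simp: fun_eq_iff chi_def biext_def Bh_zero lam_carr lam_zero)
  show "v \<in> carr H \<Longrightarrow> Phi A H Bh \<rho> 0 v = 0" "u \<in> carr H \<Longrightarrow> Phi A H Bh \<rho> u 0 = 0"
    by (auto simp: fun_eq_iff Phi_def biext_def Bh_zero)
  show "x \<in> carr A \<Longrightarrow> coad sa \<delta> A bra x 0 = 0"
    "f \<in> carr (pdual sa \<delta> A) \<Longrightarrow> coad sa \<delta> A bra 0 f = 0"
    by (auto simp: fun_eq_iff coad_def biext_def bra_zero functional_zero)
qed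

lemma gde_bracket_homogeneous:
  assumes x: "x \<in> A i" and y: "y \<in> A j" and u: "u \<in> H k" and v: "v \<in> H l"
    and f: "f \<in> pdual sa \<delta> A m" and g: "g \<in> pdual sa \<delta> A n"
  shows "bracket (x, 0, 0) (y, 0, 0) = (bra x y, lam x y, \<omega> x y)"
    and "bracket (x, 0, 0) (0, u, 0) = (0, \<rho> x u, chi A H Bh lam x u)"
    and "bracket (0, u, 0) (x, 0, 0) =
      (0, - sh (psign (k * i)) (\<rho> x u), - fun_scale (psign (k * i)) (chi A H Bh lam x u))"
    and "bracket (0, u, 0) (0, v, 0) = (0, brh u v, Phi A H Bh \<rho> u v)"
    and "bracket (x, 0, 0) (0, 0, f) = (0, 0, coad sa \<delta> A bra x f)"
    and "bracket (0, 0, f) (x, 0, 0) = (0, 0, - fun_scale (psign (m * i)) (coad sa \<delta> A bra x f))"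
    and "bracket (0, u, 0) (0, 0, f) = 0"
    and "bracket (0, 0, f) (0, u, 0) = 0"
    and "bracket (0, 0, f) (0, 0, g) = 0"
proof -
  let ?S = "biext H A (\<lambda>d e u y. sh (psign (d * e)) (\<rho> y u))"
  let ?C = "biext H A (\<lambda>d e u y. fun_scale (psign (d * e)) (chi A H Bh lam y u))"
  let ?D = "biext (pdual sa \<delta> A) A (\<lambda>d e f y. fun_scale (psign (d * e)) (coad sa \<delta> A bra y f))"
  have fs [simp]: "fun_scale c 0 = 0" for c :: 'f by (simp add: fun_scale_def fun_eq_iff)
  have D: "?D q w = fun_scale (psign (d * e)) (coad sa \<delta> A bra w q)"
    if "q \<in> pdual sa \<delta> A d" "w \<in> A e" for q w d e
    by (subst biext_homogeneous[OF p.super_space_axioms a.super_space_axioms that])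
      (auto simp: zero_maps)
  have C: "?C q w = fun_scale (psign (d * e)) (chi A H Bh lam w q)"
    if "q \<in> H d" "w \<in> A e" for q w d e
    by (subst biext_homogeneous[OF h.super_space_axioms a.super_space_axioms that])
      (auto simp: zero_maps)
  have S: "?S q w = sh (psign (d * e)) (\<rho> w q)"
    if q: "q \<in> H d" and w: "w \<in> A e" for q w d e
    using bit_cases[of d] bit_cases[of e] rho_zero(2)[OF h.part_carr[OF q]] rho_zero(1)[OF w]
      rho_zero(2)[OF zero_carr(2)]
    by (auto simp: biext_def h.hcomp_homogeneous[OF q] a.hcomp_homogeneous[OF w])
  note z = a.zero_part[of 0] h.zero_part[of 0] p.zero_part[of 0]
  note car = a.part_carr[OF x] a.part_carr[OF y] h.part_carr[OF u] h.part_carr[OF v]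
    p.part_carr[OF f] p.part_carr[OF g]
  note S' = S[OF z(2) z(1)] S[OF z(2) x] S[OF z(2) y] S[OF u z(1)] S[OF u x]
  note C' = C[OF z(2) z(1)] C[OF z(2) x] C[OF z(2) y] C[OF u z(1)] C[OF u x]
  note D' = D[OF z(3) z(1)] D[OF z(3) x] D[OF z(3) y] D[OF f z(1)] D[OF f x]
  note all = gde_bracket_def S' C' D' zero_maps bra_zero brh_zero lam_zero omega_zero rho_zero(2)
    rho_zero(1)[OF x] rho_zero(1)[OF y] zero_carr car zero_prod_def
  show "bracket (x, 0, 0) (y, 0, 0) = (bra x y, lam x y, \<omega> x y)"
    and "bracket (x, 0, 0) (0, u, 0) = (0, \<rho> x u, chi A H Bh lam x u)"
    and "bracket (0, u, 0) (x, 0, 0) =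
      (0, - sh (psign (k * i)) (\<rho> x u), - fun_scale (psign (k * i)) (chi A H Bh lam x u))"
    and "bracket (0, u, 0) (0, v, 0) = (0, brh u v, Phi A H Bh \<rho> u v)"
    and "bracket (x, 0, 0) (0, 0, f) = (0, 0, coad sa \<delta> A bra x f)"
    and "bracket (0, 0, f) (x, 0, 0) = (0, 0, - fun_scale (psign (m * i)) (coad sa \<delta> A bra x f))"
    and "bracket (0, u, 0) (0, 0, f) = 0"
    and "bracket (0, 0, f) (0, u, 0) = 0"
    and "bracket (0, 0, f) (0, 0, g) = 0"
    by (simp_all add: all del: mult_bit_eq_and add_bit_eq_xor)
qed

lemma gde_form_homogeneous:
  assumes x: "x \<in> A i" and g: "g \<in> pdual sa \<delta> A n"
  shows "gde_form Bh \<delta> sa A (x, u, f) (y, v, g) = psign (i * n) * g x + Bh u v + f y"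
  unfolding gde_form_def prod.case
  by (subst biext_homogeneous[OF a.super_space_axioms p.super_space_axioms x g])
    (auto simp: functional_zero)

end

end

theory Submission
  imports Defs
begin

text \<open>
  A proper ideal meets its orthogonal space non-trivially, for otherwise \<open>G\<close> would be decomposable;
  the intersection \<open>J\<close> is a non-zero isotropic ideal. Choose a graded complement \<open>H\<close> of \<open>J\<close> in
  the orthogonal space of \<open>J\<close> and a graded isotropic complement \<open>A\<close> of \<open>J\<close> in the orthogonal
  space of \<open>H\<close>, so that \<open>G\<close> is the direct sum of \<open>A\<close>, \<open>H\<close> and \<open>J\<close>. Then \<open>A\<close> and \<open>H\<close>, being
  complements of one ideal in another, carry the brackets of the quotients, the form identifies \<open>J\<close>
  with the shifted dual of \<open>A\<close>, and the maps \<open>\<rho>\<close>, \<open>\<lambda>\<close>, \<open>\<omega>\<close> are the components of the bracket of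
  \<open>G\<close>. The axioms of a context are the components of the Jacobi identity and of the invariance of
  the form.
\<close>

section \<open>Linear algebra\<close>

text \<open>The splitting is linear only: neither \<open>A\<close> nor \<open>H\<close> need be a
  subalgebra, and \<open>\<lambda>\<close>, \<open>\<omega>\<close>, \<open>\<chi>\<close>,
  \<open>\<Phi>\<close> record the components of brackets that leave them. The form is nondegenerate
  on \<open>H\<close> because \<open>J\<close> is its own double orthogonal space, so
  \<open>G\<close> splits into \<open>H\<close> and its orthogonal space \<open>K\<close>. A
  complement \<open>C\<close> of \<open>J\<close> in \<open>K\<close> need not be isotropic; it is
  tilted into \<open>J\<close> by minus one half of the form, which is where 2 must be invertible.
  The practical obstacle is signs: the formulas of an extension are prescribed on homogeneous
  elements only, with signs depending on degrees. Each of them is first matched with an unsigned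
  bilinear expression in \<open>br\<close> and \<open>B\<close> on all of \<open>G\<close>; the
  axioms then are components of identities already valid in \<open>G\<close>. The dual of
  \<open>A\<close> is reached by \<open>w \<mapsto> B w\<close> with \<open>w\<close> in the first
  argument, so no sign enters there, and both values of \<open>\<delta>\<close> are treated
  uniformly. A vanishing bracket needs separate care: such an algebra is non-simple by definition,
  and a proper ideal must be produced from the dimension.\<close>

lemma (in vector_space) exists_complement:
  assumes S: "subspace S" and T: "subspace T" and ST: "S \<subseteq> T"
  obtains C q where "subspace C" "C \<subseteq> T" "\<And>x. x \<in> T \<Longrightarrow> x - q x \<in> S" "\<And>x. x \<in> T \<Longrightarrow> q x \<in> C"
    "Vector_Spaces.linear scale scale q" "\<And>x. x \<in> S \<Longrightarrow> q x = 0" "\<And>x. x \<in> C \<Longrightarrow> q x = x"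
proof -
  interpret pair: vector_space_pair scale scale ..
  obtain c where c: "c \<subseteq> S" "independent c" "S \<subseteq> span c"
    using maximal_independent_subset[of S] .
  obtain e where e: "c \<subseteq> e" "e \<subseteq> T" "independent e" "T \<subseteq> span e"
    using maximal_independent_subset_extend[OF subset_trans[OF c(1) ST] c(2)] .
  \<comment> \<open>On \<open>T\<close>, \<open>p\<close> is the projection onto the span of
    \<open>e - c\<close> along \<open>S\<close>. It is handed out together with the complement
    because the isotropic complement is later cut out by a formula in this projection.\<close>
  obtain p where p: "Vector_Spaces.linear scale scale p" "\<forall>x\<in>e. p x = (if x \<in> c then 0 else x)"
    using pair.linear_independent_extend[OF e(3), of "\<lambda>x. if x \<in> c then 0 else x"] by blast
  have "p x = 0" if "x \<in> c" for x using that p(2) e(1) by auto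
  then have p_c: "p x = 0" if "x \<in> span c" for x
    using pair.linear_eq_0_on_span[OF p(1) _ that] by simp
  have "p x = id x" if "x \<in> e - c" for x using that p(2) by auto
  then have p_d: "p x = x" if "x \<in> span (e - c)" for x
    using pair.linear_eq_on[OF p(1) linear_id that] by simp
  have span_c: "span c = S" using c S by (intro antisym span_minimal)
  have split: "\<exists>a\<in>span c. \<exists>b\<in>span (e - c). x = a + b" if "x \<in> T" for x
  proof -
    have "x \<in> span (c \<union> (e - c))" using that e by (auto simp: Un_absorb1)
    then show ?thesis unfolding span_Un by blast
  qed
  show ?thesis
  proof
    show "span (e - c) \<subseteq> T" using e(2) T by (intro span_minimal) auto
    show "x - p x \<in> S" "p x \<in> span (e - c)" if "x \<in> T" for x
      using split[OF that] p_c p_d span_c by (auto simp: pair.linear_add[OF p(1)])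
    show "p x = 0" if "x \<in> S" for x using p_c that span_c by blast
  qed (simp_all add: p_d p(1))
qed

lemma (in vector_space) separating_functional:
  assumes S: "subspace S" and x: "x \<notin> S"
  obtains f where "Vector_Spaces.linear scale (*) f" "\<And>y. y \<in> S \<Longrightarrow> f y = 0" "f x = 1"
proof -
  interpret pair: vector_space_pair scale "(*) :: 'a \<Rightarrow> 'a \<Rightarrow> 'a"
    by unfold_locales (auto simp: algebra_simps)
  obtain c where c: "c \<subseteq> S" "independent c" "S \<subseteq> span c"
    using maximal_independent_subset[of S] .
  have "span c = S" using c S by (intro antisym span_minimal)
  then have "independent (insert x c)" using x c(2) by (intro independent_insertI) auto
  then obtain f where f: "Vector_Spaces.linear scale (*) f" "\<forall>y\<in>insert x c. f y = (if y = x then 1 else 0)"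
    using pair.linear_independent_extend[of "insert x c" "\<lambda>y. if y = x then 1 else 0"] by blast
  have "f y = 0" if "y \<in> S" for y
  proof (rule pair.linear_eq_0_on_span[OF f(1)])
    show "y \<in> span c" using that c by blast
    show "f z = 0" if "z \<in> c" for z using that f(2) c(1) x by auto
  qed
  then show ?thesis using f that by auto
qed

text \<open>An injective endomorphism of a finite-dimensional space is surjective. Symmetry of
  \<open>B\<close> is not assumed, so the statement also serves for super-symmetric forms, with the
  representing vector always in the first argument.\<close>

lemma (in vector_space) form_represents_functional:
  assumes S: "subspace S" and fin: "finite b" "S \<subseteq> span b"
    and B: "bilinear_map_on scale scale (*) S S B"
    and nondeg: "\<And>x. x \<in> S \<Longrightarrow> (\<And>y. y \<in> S \<Longrightarrow> B x y = 0) \<Longrightarrow> x = 0"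
    and f: "linear_map_on scale (*) S f"
  obtains x where "x \<in> S" "\<And>y. y \<in> S \<Longrightarrow> B x y = f y"
proof -
  interpret pair: vector_space_pair scale scale ..
  obtain c where c: "c \<subseteq> S" "independent c" "S \<subseteq> span c"
    using maximal_independent_subset[of S] .
  have fc: "finite c" using independent_span_bound[OF fin(1) c(2)] c(1) fin(2) by blast
  have sc: "span c = S" using c S by (intro antisym span_minimal)
  \<comment> \<open>The tuple of values \<open>B x v\<close> over the basis \<open>c\<close> is
    stored as a vector of \<open>S\<close> itself, which turns the map from \<open>S\<close> to its
    dual into an endomorphism.\<close>
  define F where "F x = (\<Sum>v\<in>c. scale (B x v) v)" for x
  \<comment> \<open>\<open>B\<close> is bilinear on \<open>S\<close> only, so \<open>F\<close> need
    not be linear outside; \<open>L\<close> is a globally linear map that agrees with it on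
    \<open>S\<close>.\<close>
  define L where "L = pair.construct c F"
  have L: "Vector_Spaces.linear scale scale L" unfolding L_def by (rule pair.linear_construct[OF c(2)])
  have LF: "L x = F x" if "x \<in> S" for x
  proof -
    have "x \<in> S \<and> L x = F x" if "x \<in> span c"
      using that
    proof (induction rule: span_induct_alt)
      case base
      have "B 0 v = 0" if "v \<in> c" for v
        using bilinear_map_on_zero(2)[OF B _ _ subspace_0[OF S]] that c(1) subspace_0[OF S] by blast
      then show ?case
        using subspace_0[OF S] pair.linear_0[OF L] by (simp add: F_def)
    next
      case (step k x y)
      have x: "x \<in> S" using step c(1) by blast
      have kx: "scale k x \<in> S" using x S by (simp add: subspace_scale)
      have "B (scale k x + y) v = k * B x v + B y v" if "v \<in> c" for v
        using B x kx step that c(1) unfolding bilinear_map_on_def linear_map_on_def by auto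
      then have "F (scale k x + y) = scale k (F x) + F y"
        by (simp add: F_def scale_left_distrib sum.distrib scale_sum_right)
      moreover have "L x = F x"
        unfolding L_def using step by (intro pair.construct_basis[OF c(2)]) auto
      ultimately show ?case
        using step kx S by (auto simp: subspace_add pair.linear_add[OF L] pair.linear_scale[OF L])
    qed
    then show ?thesis using that sc by blast
  qed
  have zero: "\<forall>v\<in>c. a v = 0" if "(\<Sum>v\<in>c. scale (a v) v) = 0" for a
    using c(2) that fc unfolding independent_explicit_finite_subsets by blast
  have inj: "inj_on L S"
  proof (rule pair.linear_inj_on_iff_eq_0[OF L S, THEN iffD2], intro ballI impI)
    fix x assume x: "x \<in> S" "L x = 0"
    then have Bv: "\<forall>v\<in>c. B x v = 0" using LF[of x] by (intro zero) (simp add: F_def)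
    have "y \<in> S \<and> B x y = 0" if "y \<in> span c" for y
      using that
    proof (induction rule: span_induct_alt)
      case base
      show ?case using bilinear_map_on_zero(1)[OF B x(1)] subspace_0[OF S] by auto
    next
      case (step k v y)
      have v: "v \<in> S" "scale k v \<in> S" using step c(1) S by (auto simp: subspace_scale)
      have "B x (scale k v + y) = k * B x v + B x y"
        using B x v step unfolding bilinear_map_on_def linear_map_on_def by auto
      then show ?case using step v Bv S by (auto simp: subspace_add)
    qed
    then show "x = 0" using nondeg[OF x(1)] sc by blast
  qed
  define t where "t = (\<Sum>v\<in>c. scale (f v) v)"
  have "L ` S \<subseteq> S"
    using LF c(1) S by (auto simp: F_def intro!: subspace_sum subspace_scale)
  have t: "t \<in> S" using c(1) S by (auto simp: t_def intro!: subspace_sum subspace_scale)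
  have indL: "independent (L ` c)"
    using inj sc by (intro pair.linear_independent_injective_image[OF L c(2)]) simp
  have cardL: "card (L ` c) = card c" using inj c(1) by (meson card_image inj_on_subset)
  \<comment> \<open>Surjectivity by counting: otherwise \<open>t\<close> and the images of the basis
    would be \<open>card c + 1\<close> independent vectors in the span of \<open>c\<close>. As
    \<open>t\<close> stores the values of \<open>f\<close>, a preimage of \<open>t\<close>
    represents \<open>f\<close>.\<close>
  have "t \<in> span (L ` c)"
  proof (rule ccontr)
    assume nt: "t \<notin> span (L ` c)"
    then have "independent (insert t (L ` c))" using indL by (rule independent_insertI)
    moreover have "insert t (L ` c) \<subseteq> span c" using t \<open>L ` S \<subseteq> S\<close> c(1) sc by auto
    ultimately have "card (insert t (L ` c)) \<le> card c" using independent_span_bound[OF fc] by blast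
    moreover have "t \<notin> L ` c" using nt span_superset by blast
    ultimately show False using fc cardL by simp
  qed
  then obtain x where x: "x \<in> S" "t = L x"
    using pair.linear_span_image[OF L, of c] sc by auto
  have "(\<Sum>v\<in>c. scale (B x v - f v) v) = 0"
    using x LF[OF x(1)] by (simp add: F_def t_def scale_left_diff_distrib sum_subtractf)
  then have Bf: "\<forall>v\<in>c. B x v = f v" using zero[of "\<lambda>v. B x v - f v"] by auto
  have "y \<in> S \<and> B x y = f y" if "y \<in> span c" for y
    using that
  proof (induction rule: span_induct_alt)
    case base
    have "f (0 + 0) = f 0 + f 0" using f subspace_0[OF S] unfolding linear_map_on_def by blast
    then have "f 0 = 0" by (metis add_0 add_cancel_right_right)
    then show ?case using bilinear_map_on_zero(1)[OF B x(1)] subspace_0[OF S] by simp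
  next
    case (step k v y)
    have v: "v \<in> S" "scale k v \<in> S" using step c(1) S by (auto simp: subspace_scale)
    have "B x (scale k v + y) = k * B x v + B x y" "f (scale k v + y) = k * f v + f y"
      using B f x v step unfolding bilinear_map_on_def linear_map_on_def by auto
    then show ?case using step v Bf S by (auto simp: subspace_add)
  qed
  then show ?thesis using that x(1) sc by blast
qed

section \<open>Super-spaces and quadratic Lie super algebras\<close>

context super_space
begin

lemma carr_zero: "0 \<in> carr V"
  using part_carr zero_part .

lemma carr_scale: assumes "x \<in> carr V" shows "s c x \<in> carr V"
proof -
  obtain a b where "a \<in> V 0" "b \<in> V 1" "x = a + b" using assms unfolding carr_def by blast
  then show ?thesis
    using subspace_scale[OF subspace_part] part_carr carr_add by (metis scale_right_distrib)
qed

lemma subspace_carr: "subspace (carr V)"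
  by (rule subspaceI) (auto simp: carr_zero carr_add carr_scale)

lemma carr_neg: "x \<in> carr V \<Longrightarrow> - x \<in> carr V"
  and carr_diff: "x \<in> carr V \<Longrightarrow> y \<in> carr V \<Longrightarrow> x - y \<in> carr V"
  by (simp_all add: subspace_neg subspace_diff subspace_carr)

lemmas part_zero = subspace_0[OF subspace_part]
  and part_add = subspace_add[OF subspace_part]
  and part_scale = subspace_scale[OF subspace_part]
  and part_diff = subspace_diff[OF subspace_part]

lemma hcomp_carr: "x \<in> carr V \<Longrightarrow> hcomp V d x \<in> carr V"
  using hcomp_part part_carr by blast

lemma hcomp_sum:
  assumes "x \<in> carr V"
  shows "hcomp V 0 x + hcomp V 1 x = x"
proof -
  obtain a b where x: "x = a + b" and a: "a \<in> V 0" and b: "b \<in> V 1"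
    using assms unfolding carr_def by blast
  have "hcomp V 0 x = a" using a b by (intro hcomp_unique) (simp_all add: x)
  moreover have "hcomp V 1 x = b" using a b by (intro hcomp_unique) (simp_all add: x)
  ultimately show ?thesis by (simp add: x)
qed

lemma hcomp_compl:
  assumes "x \<in> carr V"
  shows "x - hcomp V d x \<in> V (d + 1)"
proof -
  have "x - hcomp V 0 x = hcomp V 1 x" "x - hcomp V 1 x = hcomp V 0 x"
    using hcomp_sum[OF assms] by (simp_all add: diff_eq_eq add.commute)
  then show ?thesis using bit_cases[of d] hcomp_part[OF assms] by auto
qed

lemma hcomp_add:
  assumes "x \<in> carr V" and "y \<in> carr V"
  shows "hcomp V d (x + y) = hcomp V d x + hcomp V d y"
proof (rule hcomp_unique)
  show "hcomp V d x + hcomp V d y \<in> V d" using assms hcomp_part part_add by blast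
  have "(x - hcomp V d x) + (y - hcomp V d y) \<in> V (d + 1)"
    using assms hcomp_compl part_add by blast
  then show "x + y - (hcomp V d x + hcomp V d y) \<in> V (d + 1)" by (simp add: algebra_simps)
qed

lemma carr_induct [consumes 1, case_names part add]:
  assumes "x \<in> carr V" and "\<And>d x. x \<in> V d \<Longrightarrow> P x"
    and "\<And>x y. x \<in> carr V \<Longrightarrow> y \<in> carr V \<Longrightarrow> P x \<Longrightarrow> P y \<Longrightarrow> P (x + y)"
  shows "P x"
proof -
  obtain a b where "a \<in> V 0" "b \<in> V 1" "x = a + b"
    using assms(1) by (auto simp: carr_def)
  then show ?thesis by (metis assms(2,3) part_carr)
qed

lemma sub_super_space:
  assumes "\<And>d. subspace (W d)" and "\<And>d. W d \<subseteq> V d"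
  shows "super_space s W" and "carr W \<subseteq> carr V"
    and "x \<in> carr W \<Longrightarrow> hcomp W d x = hcomp V d x"
proof -
  have "W 0 \<inter> W 1 = {0}"
    using assms(2)[of 0] assms(2)[of 1] parts_independent
      subspace_0[OF assms(1), of 0] subspace_0[OF assms(1), of 1] by blast
  then show sup: "super_space s W"
    using assms(1) by unfold_locales
  show "carr W \<subseteq> carr V" using assms(2) using assms(2)[of 0] assms(2)[of 1] unfolding carr_def by blast
  assume x: "x \<in> carr W"
  interpret W: super_space s W by (rule sup)
  show "hcomp W d x = hcomp V d x"
    using W.hcomp_part[OF x, of d] W.hcomp_compl[OF x, of d] assms(2)[of d] assms(2)[of "d + 1"]
    by (intro hcomp_unique[symmetric]) blast+
qed

end

text \<open>The device that removes degree signs: both arguments are sums of their homogeneous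
  components, so a biadditive \<open>f\<close> is recovered from its agreement with the signed
  formula on homogeneous elements.\<close>

lemma biext_eq:
  assumes "super_space s V" and "super_space t W" and x: "x \<in> carr V" and y: "y \<in> carr W"
    and F: "\<And>d e x y. x \<in> V d \<Longrightarrow> y \<in> W e \<Longrightarrow> F d e x y = f x y"
    and add_left: "\<And>x x' y. x \<in> carr V \<Longrightarrow> x' \<in> carr V \<Longrightarrow> y \<in> carr W \<Longrightarrow> f (x + x') y = f x y + f x' y"
    and add_right: "\<And>x y y'. x \<in> carr V \<Longrightarrow> y \<in> carr W \<Longrightarrow> y' \<in> carr W \<Longrightarrow> f x (y + y') = f x y + f x y'"
  shows "biext V W F x y = f x y"
proof -
  interpret V: super_space s V by fact
  interpret W: super_space t W by fact
  have "biext V W F x y = (\<Sum>d\<in>{0,1}. \<Sum>e\<in>{0,1}. f (hcomp V d x) (hcomp W e y))"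
    unfolding biext_def using F V.hcomp_part[OF x] W.hcomp_part[OF y] by (intro sum.cong refl) auto
  also have "\<dots> = (\<Sum>d\<in>{0,1}. f (hcomp V d x) (hcomp W 0 y + hcomp W 1 y))"
    using V.hcomp_carr[OF x] W.hcomp_carr[OF y] by (intro sum.cong refl) (simp add: add_right)
  also have "\<dots> = f (hcomp V 0 x + hcomp V 1 x) y"
    using V.hcomp_carr[OF x] y by (simp add: W.hcomp_sum add_left)
  finally show ?thesis by (simp add: V.hcomp_sum x)
qed

context lie_superalgebra
begin

lemma br_part: "x \<in> L d \<Longrightarrow> y \<in> L e \<Longrightarrow> br x y \<in> L (d + e)"
  using bracket_even_bilinear unfolding even_bilinear_map_def by blast

lemma br_add_left: "x \<in> carr L \<Longrightarrow> x' \<in> carr L \<Longrightarrow> y \<in> carr L \<Longrightarrow> br (x + x') y = br x y + br x' y"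
  and br_add_right: "x \<in> carr L \<Longrightarrow> y \<in> carr L \<Longrightarrow> y' \<in> carr L \<Longrightarrow> br x (y + y') = br x y + br x y'"
  and br_scale_left: "x \<in> carr L \<Longrightarrow> y \<in> carr L \<Longrightarrow> br (s c x) y = s c (br x y)"
  and br_scale_right: "x \<in> carr L \<Longrightarrow> y \<in> carr L \<Longrightarrow> br x (s c y) = s c (br x y)"
  using bracket_even_bilinear
  unfolding even_bilinear_map_def bilinear_map_on_def linear_map_on_def by blast+

lemma br_carr:
  assumes x: "x \<in> carr L" and y: "y \<in> carr L"
  shows "br x y \<in> carr L"
  using x
proof (induction rule: carr_induct)
  case (part d x)
  note x = part
  from y show ?case
  proof (induction rule: carr_induct)
    case (part e y)
    show ?case using part_carr[OF br_part[OF x part]] .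
  qed (simp add: br_add_right carr_add part_carr[OF x])
qed (simp add: br_add_left carr_add y)

lemma br_skew: "x \<in> L d \<Longrightarrow> y \<in> L e \<Longrightarrow> br x y = - s (psign (d * e)) (br y x)"
  using bracket_skew unfolding super_skew_def by blast

text \<open>Skew-symmetry applied to \<open>br z x\<close> and to the outer bracket of
  \<open>br z (br x y)\<close> turns the cyclic identity into the derivation rule. The degree of
  \<open>z\<close> cancels from the signs, which is why \<open>z\<close> may be
  inhomogeneous.\<close>

lemma br_leibniz:
  assumes x: "x \<in> L d" and y: "y \<in> L e" and z: "z \<in> carr L"
  shows "br x (br y z) = br (br x y) z + s (psign (d * e)) (br y (br x z))"
  using z
proof (induction rule: carr_induct)
  case (part f z)
  note c = part_carr[OF x] part_carr[OF y] part_carr[OF part]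
  have zx: "br z x = - s (psign (f * d)) (br x z)" using part x by (rule br_skew)
  have zxy: "br z (br x y) = - s (psign (f * (d + e))) (br (br x y) z)"
    using part br_part[OF x y] by (rule br_skew)
  have yzx: "br y (br z x) = - s (psign (f * d)) (br y (br x z))"
    using c br_carr[of x z] by (simp add: zx scale_minus_left[symmetric] br_scale_right
        del: scale_minus_left)
  show ?case
    using jacobi[OF x y part] unfolding cyclic_sum_def yzx zxy
    using bit_cases[of d] bit_cases[of e] bit_cases[of f]
    by (auto simp: psign_def algebra_simps)
next
  case (add a b)
  note c = part_carr[OF x] part_carr[OF y] add(1,2)
  show ?case
    using add(3,4) c by (simp add: br_add_right br_carr scale_right_distrib algebra_simps)
qed

end

context quadratic_lie_superalgebra
begin

lemma form_add_left: "x \<in> carr L \<Longrightarrow> x' \<in> carr L \<Longrightarrow> y \<in> carr L \<Longrightarrow> B (x + x') y = B x y + B x' y"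
  and form_add_right: "x \<in> carr L \<Longrightarrow> y \<in> carr L \<Longrightarrow> y' \<in> carr L \<Longrightarrow> B x (y + y') = B x y + B x y'"
  and form_scale_left: "x \<in> carr L \<Longrightarrow> y \<in> carr L \<Longrightarrow> B (s c x) y = c * B x y"
  and form_scale_right: "x \<in> carr L \<Longrightarrow> y \<in> carr L \<Longrightarrow> B x (s c y) = c * B x y"
  using form_bilinear
  unfolding bilinear_map_on_def linear_map_on_def by blast+

lemma form_zero_left: "y \<in> carr L \<Longrightarrow> B 0 y = 0"
  and form_zero_right: "y \<in> carr L \<Longrightarrow> B y 0 = 0"
  using bilinear_map_on_zero[OF form_bilinear] carr_zero by blast+

lemma form_neg_left: "x \<in> carr L \<Longrightarrow> y \<in> carr L \<Longrightarrow> B (- x) y = - B x y"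
  using form_scale_left[of x y "-1"] by simp

lemma form_diff_left: "x \<in> carr L \<Longrightarrow> x' \<in> carr L \<Longrightarrow> y \<in> carr L \<Longrightarrow> B (x - x') y = B x y - B x' y"
  using form_add_left[of x "- x'" y] by (simp add: carr_neg form_neg_left)

text \<open>The complementary component has the wrong degree to pair with \<open>y\<close>. This is
  how orthogonality to a graded subspace passes from an element to its components.\<close>

lemma form_hcomp_left:
  assumes x: "x \<in> carr L" and y: "y \<in> L e"
  shows "B (hcomp L d x) y = (if d + e = \<delta> then B x y else 0)"
proof -
  have "B x y = B (hcomp L d x) y + B (x - hcomp L d x) y"
    using form_add_left[of "hcomp L d x" "x - hcomp L d x" y] hcomp_carr[OF x] x part_carr[OF y]
    by (simp add: carr_diff)
  moreover have "B (x - hcomp L d x) y = 0" if "d + e = \<delta>"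
    using form_degree[OF hcomp_compl[OF x, of d] y] that
      bit_cases[of d] bit_cases[of e] by auto
  ultimately show ?thesis
    using form_degree[OF hcomp_part[OF x, of d] y] by auto
qed

text \<open>Super-symmetry compares \<open>B x y\<close> and \<open>B y x\<close> for homogeneous
  arguments only. Since \<open>V\<close> is graded, each component of \<open>x\<close> is again
  orthogonal to the homogeneous elements of \<open>V\<close>, and there the sign is
  harmless.\<close>

lemma form_sym_zero:
  assumes V: "super_space s V" "carr V \<subseteq> carr L" "\<And>d. V d \<subseteq> L d" and x: "x \<in> carr L"
    and z: "\<And>y. y \<in> carr V \<Longrightarrow> B x y = 0" and y: "y \<in> carr V"
  shows "B y x = 0"
proof -
  interpret V: super_space s V by fact
  have hom: "B y x = 0" if y: "y \<in> V e" for y e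
  proof -
    have yL: "y \<in> L e" using V(3) y by blast
    have z': "B (hcomp L d x) y = 0" for d
      using form_hcomp_left[OF x yL] z V.part_carr[OF y] by simp
    have "B y (hcomp L d x) = 0" for d
      using form_supersymmetric[OF yL hcomp_part[OF x]] z'[of d] by simp
    then have "B y (hcomp L 0 x + hcomp L 1 x) = 0"
      using hcomp_carr[OF x] part_carr[OF yL] by (simp add: form_add_right)
    then show ?thesis using x by (simp add: hcomp_sum)
  qed
  from y show ?thesis
  proof (induction rule: V.carr_induct)
    case (add a b)
    then show ?case using V(2) x form_add_left[of a b x] by auto
  qed (rule hom)
qed

text \<open>The left and right radicals agree, again by passing to components, where super-symmetry
  costs only a sign.\<close>

lemma form_nondegenerate_right:
  assumes "x \<in> carr L" and "\<And>y. y \<in> carr L \<Longrightarrow> B y x = 0"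
  shows "x = 0"
proof (rule form_nondegenerate[OF assms(1)], rule ballI)
  fix y assume y: "y \<in> carr L"
  show "B x y = 0"
    using y
  proof (induction rule: carr_induct)
    case (part d y)
    have "B (hcomp L e x) y = 0" for e
    proof (cases "d + e = \<delta>")
      case True
      have "B y x = B y (hcomp L e x) + B y (x - hcomp L e x)"
        using form_add_right[of y "hcomp L e x" "x - hcomp L e x"] hcomp_carr[OF assms(1)]
          assms(1) part_carr[OF part] by (simp add: carr_diff)
      moreover have "B y (x - hcomp L e x) = 0"
        using form_degree[OF part hcomp_compl[OF assms(1), of e]] True
          bit_cases[of d] bit_cases[of e] by auto
      ultimately have "B y (hcomp L e x) = 0" using assms(2)[OF part_carr[OF part]] by simp
      then show ?thesis
        using form_supersymmetric[OF hcomp_part[OF assms(1)] part] by simp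
    next
      case False
      then show ?thesis
        using form_degree[OF hcomp_part[OF assms(1), of e] part] by (metis add.commute)
    qed
    then have "B (hcomp L 0 x + hcomp L 1 x) y = 0"
      using hcomp_carr[OF assms(1)] part_carr[OF part] by (simp only: form_add_left) simp
    then show ?case by (simp add: hcomp_sum assms(1))
  qed (simp add: form_add_right assms(1))
qed

end

section \<open>Witt decompositions along an isotropic ideal\<close>

text \<open>Directness of the sum and the two missing orthogonality relations are left to be derived
  from nondegeneracy and super-symmetry. \<open>form_represents\<close> stands in for finite
  dimension; it supplies the surjectivity of the map from \<open>J\<close> to the dual of
  \<open>A\<close>.\<close>

locale witt_decomposition = quadratic_lie_superalgebra s G br B \<delta>
  for s :: "'f::field \<Rightarrow> 'v::ab_group_add \<Rightarrow> 'v" and G :: "bit \<Rightarrow> 'v set"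
    and br :: "'v \<Rightarrow> 'v \<Rightarrow> 'v" and B :: "'v \<Rightarrow> 'v \<Rightarrow> 'f" and \<delta> :: bit +
  fixes A H J :: "bit \<Rightarrow> 'v set"
  assumes sub_A: "subspace (A d)" "A d \<subseteq> G d"
    and sub_H: "subspace (H d)" "H d \<subseteq> G d"
    and sub_J: "subspace (J d)" "J d \<subseteq> G d"
    and decomposition: "x \<in> G d \<Longrightarrow> \<exists>a\<in>A d. \<exists>u\<in>H d. \<exists>j\<in>J d. x = a + u + j"
    and form_AA: "x \<in> carr A \<Longrightarrow> y \<in> carr A \<Longrightarrow> B x y = 0"
    and form_AH: "x \<in> carr A \<Longrightarrow> y \<in> carr H \<Longrightarrow> B x y = 0"
    and form_HJ: "x \<in> carr H \<Longrightarrow> y \<in> carr J \<Longrightarrow> B x y = 0"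
    and form_JJ: "x \<in> carr J \<Longrightarrow> y \<in> carr J \<Longrightarrow> B x y = 0"
    and br_J: "x \<in> carr G \<Longrightarrow> y \<in> carr J \<Longrightarrow> br x y \<in> carr J"
    and form_represents: "linear_map_on s (*) (carr G) f \<Longrightarrow> \<exists>z\<in>carr G. \<forall>y\<in>carr G. B z y = f y"
begin

sublocale A: super_space s A by (rule sub_super_space(1)[OF sub_A])
sublocale H: super_space s H by (rule sub_super_space(1)[OF sub_H])
sublocale J: super_space s J by (rule sub_super_space(1)[OF sub_J])
sublocale p: super_space fun_scale "pdual s \<delta> A"
  by (rule super_space_pdual) (rule A.super_space_axioms)

lemmas carr_sub =
  subsetD[OF sub_super_space(2)[OF sub_A]] subsetD[OF sub_super_space(2)[OF sub_H]]
  subsetD[OF sub_super_space(2)[OF sub_J]]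

lemmas part_sub = subsetD[OF sub_A(2)] subsetD[OF sub_H(2)] subsetD[OF sub_J(2)]

lemma form_HA: "x \<in> carr H \<Longrightarrow> y \<in> carr A \<Longrightarrow> B x y = 0"
  using form_sym_zero[OF H.super_space_axioms _ sub_H(2), of y x] form_AH carr_sub by blast

lemma form_JH: "x \<in> carr J \<Longrightarrow> y \<in> carr H \<Longrightarrow> B x y = 0"
  using form_sym_zero[OF J.super_space_axioms _ sub_J(2), of y x] form_HJ carr_sub by blast

lemma carr_decomposition:
  assumes "x \<in> carr G"
  shows "\<exists>a\<in>carr A. \<exists>u\<in>carr H. \<exists>j\<in>carr J. x = a + u + j"
  using assms
proof (induction rule: carr_induct)
  case (part d x)
  then show ?case using decomposition A.part_carr H.part_carr J.part_carr by meson
next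
  case (add x y)
  then obtain a u j a' u' j' where "a \<in> carr A" "u \<in> carr H" "j \<in> carr J" "x = a + u + j"
    "a' \<in> carr A" "u' \<in> carr H" "j' \<in> carr J" "y = a' + u' + j'" by blast
  moreover have "a + u + j + (a' + u' + j') = (a + a') + (u + u') + (j + j')"
    by (simp add: algebra_simps)
  ultimately show ?case using A.carr_add H.carr_add J.carr_add by metis
qed

text \<open>Pairing the sum with \<open>J\<close>, \<open>H\<close> and \<open>A\<close> isolates
  \<open>a\<close>, \<open>u\<close> and \<open>j\<close> respectively, so each of them is
  orthogonal to everything.\<close>

lemma decomposition_zero:
  assumes a: "a \<in> carr A" and u: "u \<in> carr H" and j: "j \<in> carr J" and z: "a + u + j = 0"
  shows "a = 0" and "u = 0" and "j = 0"
proof -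
  note c = a[THEN carr_sub(1)] u[THEN carr_sub(2)] j[THEN carr_sub(3)]
  have B0: "B (a + u + j) y = B a y + B u y + B j y" if "y \<in> carr G" for y
    using that c by (simp add: form_add_left carr_add)
  have "B x y = 0" if x: "x = a \<or> x = u \<or> x = j" and y: "y \<in> carr G" for x y
  proof -
    obtain a' u' j' where y': "a' \<in> carr A" "u' \<in> carr H" "j' \<in> carr J" "y = a' + u' + j'"
      using carr_decomposition[OF y] by blast
    note c' = y'(1)[THEN carr_sub(1)] y'(2)[THEN carr_sub(2)] y'(3)[THEN carr_sub(3)]
    have e: "B x y = B x a' + B x u' + B x j'" if "x \<in> carr G" for x
      using that c' y'(4) by (simp add: form_add_right carr_add)
    have "B a j' = 0" "B u u' = 0" "B j a' = 0"
      using B0[of j'] B0[of u'] B0[of a'] c' z form_AA form_AH form_HA form_HJ form_JH form_JJ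
        a u j y' by (simp_all add: form_zero_left)
    then show ?thesis
      using x e c form_AA form_AH form_HA form_HJ form_JH form_JJ a u j y' by auto
  qed
  then show "a = 0" "u = 0" "j = 0" using c form_nondegenerate by blast+
qed

section \<open>Projections onto the three summands\<close>

definition pa where "pa x = (THE a. a \<in> carr A \<and> (\<exists>u\<in>carr H. \<exists>j\<in>carr J. x = a + u + j))"
definition ph where "ph x = (THE u. u \<in> carr H \<and> (\<exists>a\<in>carr A. \<exists>j\<in>carr J. x = a + u + j))"
text \<open>Taken as a remainder, so that \<open>proj_sum\<close> holds without any membership
  condition.\<close>

definition pj where "pj x = x - pa x - ph x"

lemma decomposition_unique:
  assumes "a \<in> carr A" "u \<in> carr H" "j \<in> carr J" "a' \<in> carr A" "u' \<in> carr H" "j' \<in> carr J"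
    and "a + u + j = a' + u' + j'"
  shows "a = a' \<and> u = u' \<and> j = j'"
proof -
  have "(a - a') + (u - u') + (j - j') = 0" using assms(7) by (simp add: algebra_simps)
  from decomposition_zero[OF A.carr_diff H.carr_diff J.carr_diff this] assms
  show ?thesis by (simp only: right_minus_eq)
qed

lemma proj_eq:
  assumes "a \<in> carr A" and "u \<in> carr H" and "j \<in> carr J"
  shows "pa (a + u + j) = a" and "ph (a + u + j) = u" and "pj (a + u + j) = j"
proof -
  show *: "pa (a + u + j) = a"
    unfolding pa_def by (rule the_equality) (use assms decomposition_unique in blast)+
  show "ph (a + u + j) = u"
    unfolding ph_def by (rule the_equality) (use assms decomposition_unique in blast)+
  with * show "pj (a + u + j) = j" by (simp add: pj_def)
qed

lemma proj_carr:
  assumes "x \<in> carr G"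
  shows "pa x \<in> carr A" and "ph x \<in> carr H" and "pj x \<in> carr J"
  using carr_decomposition[OF assms] by (auto simp: proj_eq)

lemma proj_carrG:
  assumes "x \<in> carr G"
  shows "pa x \<in> carr G" and "ph x \<in> carr G" and "pj x \<in> carr G"
  using proj_carr[OF assms] carr_sub by blast+

lemma proj_part:
  assumes "x \<in> G d"
  shows "pa x \<in> A d" and "ph x \<in> H d" and "pj x \<in> J d"
  using decomposition[OF assms] by (auto simp: proj_eq A.part_carr H.part_carr J.part_carr)

lemma proj_sum: "pa x + ph x + pj x = x"
  by (simp add: pj_def)

lemma proj_add:
  assumes "x \<in> carr G" and "y \<in> carr G"
  shows "pa (x + y) = pa x + pa y" and "ph (x + y) = ph x + ph y" and "pj (x + y) = pj x + pj y"
proof -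
  have "x + y = (pa x + pa y) + (ph x + ph y) + (pj x + pj y)"
    by (simp add: pj_def algebra_simps)
  then show "pa (x + y) = pa x + pa y" "ph (x + y) = ph x + ph y" "pj (x + y) = pj x + pj y"
    using proj_eq proj_carr assms A.carr_add H.carr_add J.carr_add by metis+
qed

lemma proj_scale:
  assumes "x \<in> carr G"
  shows "pa (s c x) = s c (pa x)" and "ph (s c x) = s c (ph x)"
proof -
  have "s c x = s c (pa x) + s c (ph x) + s c (pj x)"
    by (simp add: pj_def scale_right_diff_distrib)
  then show "pa (s c x) = s c (pa x)" "ph (s c x) = s c (ph x)"
    using proj_eq proj_carr assms A.carr_scale H.carr_scale J.carr_scale by metis+
qed

lemma proj_id:
  shows "x \<in> carr A \<Longrightarrow> pa x = x" and "x \<in> carr A \<Longrightarrow> ph x = 0"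
    and "x \<in> carr H \<Longrightarrow> pa x = 0" and "x \<in> carr H \<Longrightarrow> ph x = x"
    and "x \<in> carr J \<Longrightarrow> pa x = 0" and "x \<in> carr J \<Longrightarrow> ph x = 0"
  using proj_eq[of x 0 0] proj_eq[of 0 x 0] proj_eq[of 0 0 x]
  by (simp_all add: A.carr_zero H.carr_zero J.carr_zero)

lemma proj_zero: "pa 0 = 0" "ph 0 = 0"
  using proj_id A.carr_zero by blast+

text \<open>The Gram matrix of the decomposition is block antidiagonal: \<open>A\<close> pairs only
  with \<open>J\<close>, and \<open>H\<close> only with itself.\<close>

lemma form_proj:
  assumes x: "x \<in> carr G"
  shows "y \<in> carr A \<Longrightarrow> B x y = B (pj x) y" and "y \<in> carr A \<Longrightarrow> B y x = B y (pj x)"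
    and "y \<in> carr H \<Longrightarrow> B x y = B (ph x) y" and "y \<in> carr H \<Longrightarrow> B y x = B y (ph x)"
    and "y \<in> carr J \<Longrightarrow> B x y = B (pa x) y" and "y \<in> carr J \<Longrightarrow> B y x = B y (pa x)"
proof -
  have l: "B x y = B (pa x) y + B (ph x) y + B (pj x) y" if "y \<in> carr G" for y
    using that proj_carrG[OF x] proj_sum[of x] form_add_left carr_add by metis
  have r: "B y x = B y (pa x) + B y (ph x) + B y (pj x)" if "y \<in> carr G" for y
    using that proj_carrG[OF x] proj_sum[of x] form_add_right carr_add by metis
  note f = form_AA form_AH form_HA form_HJ form_JH form_JJ proj_carr[OF x] carr_sub
  show "y \<in> carr A \<Longrightarrow> B x y = B (pj x) y" "y \<in> carr A \<Longrightarrow> B y x = B y (pj x)"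
    "y \<in> carr H \<Longrightarrow> B x y = B (ph x) y" "y \<in> carr H \<Longrightarrow> B y x = B y (ph x)"
    "y \<in> carr J \<Longrightarrow> B x y = B (pa x) y" "y \<in> carr J \<Longrightarrow> B y x = B y (pa x)"
    by (simp_all add: l r f)
qed

text \<open>The shape of \<open>gde_form\<close>. The first and last terms do not count anything
  twice because \<open>A\<close> is isotropic.\<close>

lemma form_eq:
  assumes "x \<in> carr G" and "y \<in> carr G"
  shows "B x y = B (pa x) y + B (ph x) (ph y) + B x (pa y)"
proof -
  have "B x y = B (pa x) y + B (ph x) y + B (pj x) y"
    using assms proj_carrG proj_sum[of x] form_add_left carr_add by metis
  moreover have "B (ph x) y = B (ph x) (ph y)" using assms form_proj(4) proj_carr by blast
  moreover have "B (pj x) y = B (pj x) (pa y)" using assms form_proj(6) proj_carr by blast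
  moreover have "B x (pa y) = B (pj x) (pa y)" using assms form_proj(1) proj_carr by blast
  ultimately show ?thesis by simp
qed

text \<open>Together with \<open>perp_J\<close> this identifies the orthogonal space of
  \<open>J\<close> with the kernel of \<open>pa\<close>. From here on \<open>pa w = 0\<close> is the
  working form of orthogonality to \<open>J\<close>.\<close>

lemma pa_zero_left: "pa x = 0" if x: "x \<in> carr G" and z: "\<And>j. j \<in> carr J \<Longrightarrow> B x j = 0"
proof (rule form_nondegenerate)
  show "pa x \<in> carr G" by (rule proj_carrG[OF x])
  have "B (pa x) y = 0" if "y \<in> carr G" for y
  proof -
    have "B (pa x) y = B (pa x) (pa y) + B (pa x) (ph y) + B (pa x) (pj y)"
      using x that proj_carrG proj_sum[of y] form_add_right carr_add by metis
    then show ?thesis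
      using x that z form_proj(5)[OF x, of "pj y"] by (simp add: form_AA form_AH proj_carr)
  qed
  then show "\<forall>y\<in>carr G. B (pa x) y = 0" by blast
qed

lemma pa_zero_right: "pa x = 0" if x: "x \<in> carr G" and z: "\<And>j. j \<in> carr J \<Longrightarrow> B j x = 0"
proof (rule form_nondegenerate_right)
  show "pa x \<in> carr G" by (rule proj_carrG[OF x])
  show "B y (pa x) = 0" if "y \<in> carr G" for y
  proof -
    have "B y (pa x) = B (pa y) (pa x) + B (ph y) (pa x) + B (pj y) (pa x)"
      using x that proj_carrG proj_sum[of y] form_add_left carr_add by metis
    then show ?thesis
      using x that z form_proj(6)[OF x, of "pj y"] by (simp add: form_AA form_HA proj_carr)
  qed
qed

lemma perp_J:
  assumes "x \<in> carr G" and "pa x = 0" and "y \<in> carr J"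
  shows "B x y = 0" and "B y x = 0"
  using form_proj(5,6)[OF assms(1,3)] assms carr_sub(3)[OF assms(3)]
  by (simp_all add: form_zero_left form_zero_right)

section \<open>Brackets with \<open>J\<close> and with its orthogonal space\<close>

lemma br_J_right:
  assumes x: "x \<in> carr J" and y: "y \<in> carr G"
  shows "br x y \<in> carr J"
  using x
proof (induction rule: J.carr_induct)
  case (part d x)
  note x = part
  from y show ?case
  proof (induction rule: carr_induct)
    case (part e y)
    have "br y x \<in> carr J" using part_carr[OF part] J.part_carr[OF x] by (rule br_J)
    then show ?case
      using br_skew[OF part_sub(3)[OF x] part] by (simp add: J.carr_neg J.carr_scale)
  qed (simp add: br_add_right carr_sub J.part_carr[OF x] J.carr_add)
qed (simp add: br_add_left carr_sub J.carr_add y)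

text \<open>The orthogonal space of an ideal is an ideal: invariance moves the bracket with
  \<open>x\<close> onto the element of \<open>J\<close>.\<close>

lemma pa_br_perp:
  assumes x: "x \<in> carr G" and w: "w \<in> carr G" "pa w = 0"
  shows "pa (br x w) = 0" and "pa (br w x) = 0"
proof -
  show "pa (br x w) = 0"
  proof (rule pa_zero_right[OF br_carr[OF x w(1)]])
    show "B j (br x w) = 0" if "j \<in> carr J" for j
      using form_invariant[OF carr_sub(3)[OF that] x w(1)] perp_J(2)[OF w br_J_right[OF that x]]
      by simp
  qed
  show "pa (br w x) = 0"
  proof (rule pa_zero_left[OF br_carr[OF w(1) x]])
    show "B (br w x) j = 0" if "j \<in> carr J" for j
      using form_invariant[OF w(1) x carr_sub(3)[OF that]] perp_J(1)[OF w br_J[OF x that]]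
      by simp
  qed
qed

text \<open>\<open>B (br w j) y = B w (br j y) = 0\<close> for every \<open>y\<close>, since
  \<open>br j y\<close> stays in \<open>J\<close>. This is why in the extension the dual of
  \<open>A\<close> is abelian and commutes with \<open>H\<close>.\<close>

lemma br_perp_J:
  assumes w: "w \<in> carr G" "pa w = 0" and j: "j \<in> carr J"
  shows "br w j = 0" and "br j w = 0"
proof -
  note jG = carr_sub(3)[OF j]
  show "br w j = 0"
    using form_nondegenerate[OF br_carr[OF w(1) jG]] form_invariant[OF w(1) jG]
      perp_J(1)[OF w br_J_right[OF j]] by simp
  show "br j w = 0"
    using form_nondegenerate_right[OF br_carr[OF jG w(1)]] form_invariant[OF _ jG w(1), symmetric]
      perp_J(2)[OF w br_J[OF _ j]] by simp
qed

lemma br_split_right: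
  assumes "x \<in> carr G" and "w \<in> carr G"
  shows "br x w = br x (pa w) + br x (ph w) + br x (pj w)"
  using assms proj_carrG proj_sum[of w] br_add_right carr_add by metis

lemma br_split_left:
  assumes "x \<in> carr G" and "w \<in> carr G"
  shows "br w x = br (pa w) x + br (ph w) x + br (pj w) x"
  using assms proj_carrG proj_sum[of w] br_add_left carr_add by metis

lemma pa_br:
  assumes "x \<in> carr G" and "w \<in> carr G"
  shows "pa (br x (pa w)) = pa (br x w)" and "pa (br (pa w) x) = pa (br w x)"
  using assms br_split_right[OF assms] br_split_left[OF assms] proj_carrG[OF assms(2)]
    proj_carr[OF assms(2)]
  by (simp_all add: proj_add br_carr carr_add pa_br_perp proj_id)

text \<open>Only two of the three components of \<open>w\<close> survive: brackets with the
  \<open>J\<close>-component land in \<open>J\<close>, which \<open>ph\<close> kills. On the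
  orthogonal space of \<open>J\<close> the \<open>pa\<close> term also disappears, and
  \<open>ph\<close> acts as the quotient map modulo \<open>J\<close>.\<close>

lemma ph_br:
  assumes "x \<in> carr G" and "w \<in> carr G"
  shows "ph (br x (pa w)) + ph (br x (ph w)) = ph (br x w)"
    and "ph (br (pa w) x) + ph (br (ph w) x) = ph (br w x)"
  using assms br_split_right[OF assms] br_split_left[OF assms] proj_carrG[OF assms(2)]
    proj_carr[OF assms(2)]
  by (simp_all add: proj_add br_carr carr_add br_J br_J_right proj_id)

lemma ph_br_perp:
  assumes "x \<in> carr G" and "w \<in> carr G" and "pa w = 0"
  shows "ph (br x (ph w)) = ph (br x w)" and "ph (br (ph w) x) = ph (br w x)"
proof -
  have "br x 0 = 0" "br 0 x = 0"
    using br_scale_right[of x 0 0] br_scale_left[of 0 x 0] assms(1) carr_zero by simp_all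
  then show "ph (br x (ph w)) = ph (br x w)" "ph (br (ph w) x) = ph (br w x)"
    using ph_br[OF assms(1,2)] assms(3) by (simp_all add: proj_zero)
qed

section \<open>The brackets of \<open>A\<close> and \<open>H\<close>\<close>

definition bra where "bra x y = pa (br x y)"
text \<open>Deliberately not confined to \<open>H\<close>: the same function serves as the bracket
  of \<open>H\<close> on two elements of \<open>H\<close>, as \<open>\<rho>\<close> on one of
  \<open>A\<close> and one of \<open>H\<close>, and as \<open>\<lambda>\<close> on two elements of
  \<open>A\<close>.\<close>

definition brh where "brh x y = ph (br x y)"

lemma proj_cyclic_sum:
  assumes "F x y z \<in> carr G" "F y z x \<in> carr G" "F z x y \<in> carr G"
  shows "pa (cyclic_sum s d e f F x y z) = cyclic_sum s d e f (\<lambda>x y z. pa (F x y z)) x y z"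
    and "ph (cyclic_sum s d e f F x y z) = cyclic_sum s d e f (\<lambda>x y z. ph (F x y z)) x y z"
  using assms unfolding cyclic_sum_def by (simp_all only: proj_add proj_scale carr_add carr_scale)

lemma proj_skew:
  assumes "x \<in> G d" and "y \<in> G e"
  shows "pa (br x y) = - s (psign (d * e)) (pa (br y x))"
    and "ph (br x y) = - s (psign (d * e)) (ph (br y x))"
proof -
  have "br x y = s (- psign (d * e)) (br y x)" using br_skew[OF assms] by simp
  moreover have "br y x \<in> carr G" using assms part_carr br_carr by blast
  ultimately show "pa (br x y) = - s (psign (d * e)) (pa (br y x))"
    "ph (br x y) = - s (psign (d * e)) (ph (br y x))"
    by (simp_all only: proj_scale flip: scale_minus_left)
qed

lemmas br_linear = br_add_left br_add_right br_scale_left br_scale_right br_carr carr_add carr_scale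

lemma lie_A: "lie_superalgebra s A bra"
proof
  show "even_bilinear_map s s s A A A bra"
    unfolding even_bilinear_map_def bilinear_map_on_def linear_map_on_def bra_def
    using proj_part(1)[OF br_part[OF part_sub(1) part_sub(1)]]
    by (simp add: carr_sub br_linear proj_add proj_scale del: add_bit_eq_xor)
  show "super_skew s A bra"
    unfolding super_skew_def bra_def by (intro allI ballI proj_skew(1) part_sub(1))
  fix x y z d e f assume xyz: "x \<in> A d" "y \<in> A e" "z \<in> A f"
  note G = xyz[THEN part_sub(1)]
  note c = G[THEN part_carr]
  have "cyclic_sum s d e f (\<lambda>x y z. bra x (bra y z)) x y z =
      cyclic_sum s d e f (\<lambda>x y z. pa (br x (br y z))) x y z"
    using c by (simp add: cyclic_sum_def bra_def pa_br br_carr)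
  also have "\<dots> = pa (cyclic_sum s d e f (\<lambda>x y z. br x (br y z)) x y z)"
    using c by (intro proj_cyclic_sum(1)[symmetric]) (simp_all add: br_carr)
  finally show "cyclic_sum s d e f (\<lambda>x y z. bra x (bra y z)) x y z = 0"
    by (simp add: jacobi[OF G] proj_zero)
qed

lemma quadratic_H: "quadratic_lie_superalgebra s H brh B \<delta>"
proof
  show "even_bilinear_map s s s H H H brh"
    unfolding even_bilinear_map_def bilinear_map_on_def linear_map_on_def brh_def
    using proj_part(2)[OF br_part[OF part_sub(2) part_sub(2)]]
    by (simp add: carr_sub br_linear proj_add proj_scale del: add_bit_eq_xor)
  show "super_skew s H brh"
    unfolding super_skew_def brh_def by (intro allI ballI proj_skew(2) part_sub(2))
  show "cyclic_sum s d e f (\<lambda>x y z. brh x (brh y z)) x y z = 0"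
    if xyz: "x \<in> H d" "y \<in> H e" "z \<in> H f" for x y z d e f
  proof -
    note G = xyz[THEN part_sub(2)]
    note c = G[THEN part_carr] xyz[THEN H.part_carr]
    have pa0: "pa (br u v) = 0" if "u \<in> carr H" "v \<in> carr H" for u v
      using pa_br_perp(1)[OF carr_sub(2)[OF that(1)] carr_sub(2)[OF that(2)] proj_id(3)[OF that(2)]] .
    have "cyclic_sum s d e f (\<lambda>x y z. brh x (brh y z)) x y z =
        cyclic_sum s d e f (\<lambda>x y z. ph (br x (br y z))) x y z"
      using c by (simp add: cyclic_sum_def brh_def ph_br_perp br_carr pa0)
    also have "\<dots> = ph (cyclic_sum s d e f (\<lambda>x y z. br x (br y z)) x y z)"
      using c by (intro proj_cyclic_sum(2)[symmetric]) (simp_all add: br_carr)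
    finally show ?thesis by (simp add: jacobi[OF G] proj_zero)
  qed
  show "bilinear_map_on s s (*) (carr H) (carr H) B"
    using form_bilinear carr_sub(2) unfolding bilinear_map_on_def linear_map_on_def by blast
  show "x = 0" if x: "x \<in> carr H" "\<forall>y\<in>carr H. B x y = 0" for x
  proof (rule form_nondegenerate[OF carr_sub(2)[OF x(1)]], rule ballI)
    fix y assume y: "y \<in> carr G"
    show "B x y = 0" using form_proj(4)[OF y x(1)] x(2) proj_carr(2)[OF y] by simp
  qed
  show "B x y = psign (d * e) * B y x" if "x \<in> H d" "y \<in> H e" for x y d e
    using form_supersymmetric[OF that[THEN part_sub(2)]] .
  show "B (brh x y) z = B x (brh y z)" if "x \<in> carr H" "y \<in> carr H" "z \<in> carr H" for x y z
    using that carr_sub(2) form_invariant[of x y z] form_proj(3)[of "br x y" z]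
      form_proj(4)[of "br y z" x] by (simp add: brh_def br_carr)
  show "B x y = 0" if "x \<in> H d" "y \<in> H e" "d + e \<noteq> \<delta>" for x y d e
    using form_degree[OF that(1,2)[THEN part_sub(2)] that(3)] .
qed

end

section \<open>The context of a generalized double extension\<close>

lemma carr_parity_shift: "carr (parity_shift \<delta> V) = carr V"
  using bit_cases[of \<delta>] by (auto simp: carr_def parity_shift_def) (metis add.commute)+

context witt_decomposition
begin

text \<open>Restricted to \<open>J\<close>, this is the isomorphism with the shifted dual of \<open>A\<close>.\<close>

definition fn :: "'v \<Rightarrow> 'v \<Rightarrow> 'f" where "fn w = (\<lambda>y. if y \<in> carr A then B w y else 0)"

lemma fn_apply: "y \<in> carr A \<Longrightarrow> fn w y = B w y"
  by (simp add: fn_def)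

lemma fn_add: "x \<in> carr G \<Longrightarrow> y \<in> carr G \<Longrightarrow> fn (x + y) = fn x + fn y"
  by (auto simp: fn_def fun_eq_iff form_add_left carr_sub)

lemma fn_scale: "x \<in> carr G \<Longrightarrow> fn (s c x) = fun_scale c (fn x)"
  by (auto simp: fn_def fun_eq_iff fun_scale_def form_scale_left carr_sub)

lemma fn_neg: "x \<in> carr G \<Longrightarrow> fn (- x) = - fn x"
  by (auto simp: fn_def fun_eq_iff form_neg_left carr_sub)

lemma fn_zero: "x \<in> carr A \<or> x \<in> carr H \<Longrightarrow> fn x = 0"
  by (auto simp: fn_def fun_eq_iff form_AA form_HA)

text \<open>\<open>A\<close> and \<open>H\<close> are orthogonal to \<open>A\<close>, so
  \<open>fn\<close> discards their components by itself. Hence \<open>fn x\<close> can serve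
  directly as the last coordinate of \<open>phi\<close>, and \<open>J\<close>-components of
  identities are obtained by applying \<open>fn\<close> to them in \<open>G\<close>.\<close>

lemma fn_pj: "w \<in> carr G \<Longrightarrow> fn (pj w) = fn w"
  by (auto simp: fn_def fun_eq_iff form_proj(1))

lemma pdual_iff:
  "f \<in> pdual s \<delta> A d \<longleftrightarrow> linear_map_on s (*) (carr A) f \<and> (\<forall>x. x \<notin> carr A \<longrightarrow> f x = 0) \<and>
     (\<forall>x\<in>A (d + 1 + \<delta>). f x = 0)"
  unfolding pdual_def dual_def carr_parity_shift by (simp add: parity_shift_def)

lemma fn_linear: "w \<in> carr G \<Longrightarrow> linear_map_on s (*) (carr A) (fn w)"
  unfolding linear_map_on_def
  by (simp add: fn_apply A.carr_add A.carr_scale form_add_right form_scale_right carr_sub)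

text \<open>The functionals in \<open>pdual s \<delta> A d\<close> vanish on
  \<open>A (d + 1 + \<delta>)\<close>, which is exactly the degree that a form of degree
  \<open>\<delta>\<close> does not pair with degree \<open>d\<close>.\<close>

lemma fn_part:
  assumes "w \<in> G d"
  shows "fn w \<in> pdual s \<delta> A d"
  unfolding pdual_iff
proof (intro conjI allI impI ballI)
  fix x assume x: "x \<in> A (d + 1 + \<delta>)"
  have "d + (d + 1 + \<delta>) \<noteq> \<delta>" using bit_cases[of d] bit_cases[of \<delta>] by auto
  then show "fn w x = 0"
    using form_degree[OF assms part_sub(1)[OF x]] fn_apply[OF A.part_carr[OF x]] by simp
qed (use part_carr[OF assms] in \<open>simp_all add: fn_linear\<close>, simp add: fn_def)

text \<open>\<open>fn\<close> is even, hence compatible with components. This lets a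
  \<open>biext\<close> over the shifted dual be rewritten as one over \<open>J\<close> or
  \<open>G\<close>.\<close>

lemma hcomp_fn:
  assumes "w \<in> carr G"
  shows "hcomp (pdual s \<delta> A) e (fn w) = fn (hcomp G e w)"
proof (rule p.hcomp_unique)
  show "fn (hcomp G e w) \<in> pdual s \<delta> A e" by (rule fn_part[OF hcomp_part[OF assms]])
  have "fn w = fn (hcomp G e w) + fn (w - hcomp G e w)"
    using fn_add[OF hcomp_carr[OF assms], of "w - hcomp G e w" e] assms
    by (simp add: carr_diff hcomp_carr)
  moreover have "fn (w - hcomp G e w) \<in> pdual s \<delta> A (e + 1)"
    by (rule fn_part[OF hcomp_compl[OF assms]])
  ultimately show "fn w - fn (hcomp G e w) \<in> pdual s \<delta> A (e + 1)" by simp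
qed

text \<open>Extended to \<open>G\<close> through \<open>pa\<close>, the functional is represented by
  some \<open>z\<close>; only the \<open>J\<close>-component of \<open>z\<close> matters on
  \<open>A\<close>.\<close>

lemma fn_surj:
  assumes f: "linear_map_on s (*) (carr A) f" "\<And>x. x \<notin> carr A \<Longrightarrow> f x = 0"
  shows "\<exists>j\<in>carr J. fn j = f"
proof -
  have "linear_map_on s (*) (carr G) (\<lambda>y. f (pa y))"
    using f unfolding linear_map_on_def by (simp add: proj_add proj_scale proj_carr)
  then obtain z where z: "z \<in> carr G" "\<forall>y\<in>carr G. B z y = f (pa y)"
    using form_represents by blast
  have "fn z = f"
    using z f by (auto simp: fn_def fun_eq_iff carr_sub proj_id)
  then show ?thesis using fn_pj z(1) proj_carr(3) by blast
qed

text \<open>Invariance gives \<open>B w (br x y) = B (br w x) y\<close>, and the sign in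
  \<open>coad\<close> is the one that turns \<open>br w x\<close> into \<open>br x w\<close>. On the
  right \<open>pj w\<close> is essential, since \<open>fn w\<close> does not see the other
  components of \<open>w\<close> while \<open>br x w\<close> does.\<close>

lemma coad_fn:
  assumes x: "x \<in> carr A" and w: "w \<in> carr G"
  shows "coad s \<delta> A bra x (fn w) = fn (br x (pj w))"
proof -
  let ?F = "\<lambda>d e x f y. if y \<in> carr A then - (psign (e * d) * f (bra x y)) else 0"
  have j: "pj w \<in> carr J" "pj w \<in> carr G" using proj_carr(3) proj_carrG(3) w by blast+
  \<comment> \<open>The components of the functional are those of the representing element of
    \<open>J\<close>, so the bilinear extension may be taken over \<open>J\<close>.\<close>
  have "hcomp (pdual s \<delta> A) e (fn w) = fn (hcomp J e (pj w))" for e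
    using hcomp_fn[OF j(2)] fn_pj[OF w] sub_super_space(3)[OF sub_J j(1)] by simp
  then have "coad s \<delta> A bra x (fn w) = biext A J (\<lambda>d e x w. ?F d e x (fn w)) x (pj w)"
    unfolding coad_def biext_def by (simp only:)
  also have "\<dots> = fn (br x (pj w))"
  proof (rule biext_eq[OF A.super_space_axioms J.super_space_axioms x j(1)])
    fix d e x w assume x: "x \<in> A d" and w: "w \<in> J e"
    note xG = part_sub(1)[OF x] and wG = part_sub(3)[OF w]
    note c = part_carr[OF xG] part_carr[OF wG]
    have "- (psign (e * d) * fn w (bra x y)) = B (br x w) y" if y: "y \<in> carr A" for y
    proof -
      note yG = carr_sub(1)[OF y]
      have "fn w (bra x y) = B w (pa (br x y))"
        using proj_carr(1)[OF br_carr[OF c(1) yG]] by (simp add: bra_def fn_apply)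
      also have "\<dots> = B w (br x y)"
        using form_proj(6)[OF br_carr[OF c(1) yG] J.part_carr[OF w]] by simp
      also have "\<dots> = B (br w x) y" using form_invariant[OF c(2,1) yG] by simp
      also have "br w x = s (- psign (e * d)) (br x w)" using br_skew[OF wG xG] by simp
      also have "B \<dots> y = - (psign (e * d) * B (br x w) y)"
        using form_scale_left[OF br_carr[OF c] yG, of "- psign (e * d)"] by simp
      finally show ?thesis by (auto simp: psign_def)
    qed
    then show "?F d e x (fn w) = fn (br x w)" by (simp add: fn_def fun_eq_iff)
  qed (simp_all only: carr_sub br_linear fn_add)
  finally show ?thesis .
qed

text \<open>Invariance twice, with one swap in between: \<open>B (br x u) y = B x (br u y)\<close>,
  and \<open>B x (br y u) = B (br x y) u\<close>. The swap of \<open>u\<close> and \<open>y\<close>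
  accounts for the sign in \<open>\<chi>\<close>.\<close>

lemma chi_fn:
  assumes x: "x \<in> carr A" and u: "u \<in> carr H"
  shows "chi A H B brh x u = fn (br x u)"
proof
  fix y
  note xG = carr_sub(1)[OF x]
  show "chi A H B brh x u y = fn (br x u) y"
  proof (cases "y \<in> carr A")
    case True
    have "biext H A (\<lambda>d e u y. - (psign (d * e) * B (brh x y) u)) u y = B (br x u) y"
    proof (rule biext_eq[OF H.super_space_axioms A.super_space_axioms u True])
      fix d e u y assume u: "u \<in> H d" and y: "y \<in> A e"
      note uG = part_sub(2)[OF u] and yG = part_sub(1)[OF y]
      note c = part_carr[OF uG] part_carr[OF yG]
      have "B (br x u) y = B x (br u y)" using form_invariant[OF xG c] .
      also have "br u y = s (- psign (d * e)) (br y u)" using br_skew[OF uG yG] by simp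
      also have "B x \<dots> = - psign (d * e) * B x (br y u)"
        by (rule form_scale_right[OF xG br_carr[OF c(2,1)]])
      also have "B x (br y u) = B (br x y) u" using form_invariant[OF xG c(2,1)] by simp
      also have "\<dots> = B (brh x y) u"
        unfolding brh_def by (rule form_proj(3)[OF br_carr[OF xG c(2)] H.part_carr[OF u]])
      finally show "- (psign (d * e) * B (brh x y) u) = B (br x u) y" by simp
    qed (simp_all add: xG carr_sub br_linear form_add_left form_add_right)
    then show ?thesis using True by (simp add: chi_def fn_def)
  qed (simp add: chi_def fn_def)
qed

text \<open>\<open>B (br x u) v = B x (br u v)\<close>, followed by super-symmetry; this is checked
  for each component of \<open>x\<close> separately because the sign depends on its degree.\<close>

lemma Phi_fn:
  assumes u: "u \<in> carr H" and v: "v \<in> carr H"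
  shows "Phi A H B brh u v = fn (br u v)"
proof
  fix x
  show "Phi A H B brh u v x = fn (br u v) x"
  proof (cases "x \<in> carr A")
    case True
    note xG = carr_sub(1)[OF True]
    have "biext H H (\<lambda>d e u v. \<Sum>k\<in>{0,1}. psign (k * (d + e)) * B (brh (hcomp A k x) u) v) u v
        = B (br u v) x"
    proof (rule biext_eq[OF H.super_space_axioms H.super_space_axioms u v])
      fix d e u v assume u: "u \<in> H d" and v: "v \<in> H e"
      note uG = part_sub(2)[OF u] and vG = part_sub(2)[OF v]
      note c = part_carr[OF uG] part_carr[OF vG]
      have "psign (k * (d + e)) * B (brh (hcomp A k x) u) v = B (br u v) (hcomp A k x)" for k
      proof -
        let ?x = "hcomp A k x"
        have x: "?x \<in> G k" using A.hcomp_part[OF True] part_sub(1) by blast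
        note xc = part_carr[OF x]
        have "B (brh ?x u) v = B (br ?x u) v"
          unfolding brh_def by (rule form_proj(3)[OF br_carr[OF xc c(1)] H.part_carr[OF v], symmetric])
        also have "\<dots> = B ?x (br u v)" by (rule form_invariant[OF xc c])
        finally show ?thesis
          using form_supersymmetric[OF br_part[OF uG vG] x] by (metis mult.commute)
      qed
      then have "(\<Sum>k\<in>{0,1}. psign (k * (d + e)) * B (brh (hcomp A k x) u) v) =
          B (br u v) (hcomp A 0 x) + B (br u v) (hcomp A 1 x)" by simp
      also have "\<dots> = B (br u v) (hcomp A 0 x + hcomp A 1 x)"
        using c A.hcomp_carr[OF True] by (simp add: form_add_right br_carr carr_sub)
      finally show "(\<Sum>k\<in>{0,1}. psign (k * (d + e)) * B (brh (hcomp A k x) u) v) = B (br u v) x"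
        by (simp add: A.hcomp_sum[OF True])
    qed (simp_all add: xG carr_sub br_linear form_add_left)
    then show ?thesis using True by (simp add: Phi_def fn_def)
  qed (simp add: Phi_def fn_def)
qed

definition om where "om x y = fn (br x y)"

lemma fn_cyclic_sum:
  assumes "F x y z \<in> carr G" "F y z x \<in> carr G" "F z x y \<in> carr G"
  shows "fn (cyclic_sum s d e f F x y z) = cyclic_sum fun_scale d e f (\<lambda>x y z. fn (F x y z)) x y z"
  using assms unfolding cyclic_sum_def by (simp only: fn_add fn_scale carr_add carr_scale)

lemma fn_skew:
  assumes "x \<in> G d" and "y \<in> G e"
  shows "fn (br x y) = - fun_scale (psign (d * e)) (fn (br y x))"
proof -
  have c: "br y x \<in> carr G" using assms part_carr br_carr by blast
  have "fn (br x y) = - fn (s (psign (d * e)) (br y x))"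
    using br_skew[OF assms] c by (simp add: fn_neg carr_scale)
  then show ?thesis by (simp add: fn_scale c)
qed

text \<open>Bracketing with \<open>x\<close> preserves both \<open>J\<close> and its orthogonal
  space, hence acts on the quotient; the rule is the \<open>ph\<close>-image of
  \<open>br_leibniz\<close>.\<close>

lemma brh_der:
  assumes x: "x \<in> A k"
  shows "brh x \<in> Der s H brh k"
proof -
  note xG = part_sub(1)[OF x]
  note xc = part_carr[OF xG]
  have "brh x (brh u v) = brh (brh x u) v + s (psign (k * d)) (brh u (brh x v))"
    if u: "u \<in> H d" and v: "v \<in> carr H" for u v d
  proof -
    note uG = part_sub(2)[OF u] and c = part_carr[OF part_sub(2)[OF u]] carr_sub(2)[OF v]
    have pa0: "pa (br g u) = 0" "pa (br g v) = 0" if "g \<in> carr G" for g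
      using pa_br_perp(1)[OF that] c proj_id(3) H.part_carr[OF u] v by blast+
    show ?thesis
      using br_leibniz[OF xG uG c(2)] xc c
      by (simp add: brh_def ph_br_perp br_carr pa0 proj_add proj_scale carr_scale)
  qed
  then show ?thesis
    unfolding Der_def hom_maps_def linear_map_on_def
    using proj_part(2)[OF br_part[OF xG part_sub(2)]]
    by (simp add: brh_def carr_sub xc br_linear proj_add proj_scale add.commute[of k]
        del: add_bit_eq_xor)
qed

lemma brh_ortho:
  assumes x: "x \<in> A k"
  shows "brh x \<in> ortho s H B k"
proof -
  note xG = part_sub(1)[OF x]
  note xc = part_carr[OF xG]
  have "B (brh x u) v = - (psign (d * k) * B u (brh x v))" if u: "u \<in> H d" and v: "v \<in> carr H" for u v d
  proof -
    note uG = part_sub(2)[OF u] and c = part_carr[OF part_sub(2)[OF u]] carr_sub(2)[OF v]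
    have "B (brh x u) v = B (br x u) v"
      using form_proj(3)[OF br_carr[OF xc c(1)] v] by (simp add: brh_def)
    also have "br x u = s (- psign (k * d)) (br u x)" using br_skew[OF xG uG] by simp
    also have "B \<dots> v = - psign (k * d) * B (br u x) v"
      by (rule form_scale_left[OF br_carr[OF c(1) xc] c(2)])
    also have "B (br u x) v = B u (br x v)" by (rule form_invariant[OF c(1) xc c(2)])
    also have "\<dots> = B u (brh x v)"
      using form_proj(4)[OF br_carr[OF xc c(2)] H.part_carr[OF u]] by (simp add: brh_def)
    finally show ?thesis by (simp add: mult.commute)
  qed
  then show ?thesis
    using brh_der[OF x] unfolding ortho_def Der_def by blast
qed

lemma gde_context_om: "gde_context s H brh B \<delta> s A bra brh brh om"
proof -
  interpret h: quadratic_lie_superalgebra s H brh B \<delta> by (rule quadratic_H)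
  interpret a: lie_superalgebra s A bra by (rule lie_A)
  have AG: "x \<in> G d" "x \<in> carr A" "x \<in> carr G" if "x \<in> A d" for x d
    using that part_sub(1) A.part_carr part_carr by blast+
  show ?thesis
  proof
    show "linear_map_on s s (carr A) (\<lambda>x. brh x u)" if "u \<in> carr H" for u
      using that unfolding linear_map_on_def brh_def
      by (simp add: carr_sub br_linear proj_add proj_scale)
    show "brh x \<in> Der s H brh d \<inter> ortho s H B d" if "x \<in> A d" for x d
      using brh_der brh_ortho that by blast
    show "even_bilinear_map s s s A A H brh"
      unfolding even_bilinear_map_def bilinear_map_on_def linear_map_on_def brh_def
      using proj_part(2)[OF br_part[OF part_sub(1) part_sub(1)]]
      by (simp add: carr_sub br_linear proj_add proj_scale del: add_bit_eq_xor)
    show "super_skew s A brh"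
      unfolding super_skew_def brh_def by (intro allI ballI proj_skew(2) part_sub(1))
    show "even_bilinear_map s s fun_scale A A (pdual s \<delta> A) om"
      unfolding even_bilinear_map_def bilinear_map_on_def linear_map_on_def om_def
      using fn_part[OF br_part[OF part_sub(1) part_sub(1)]]
      by (simp add: carr_sub br_linear fn_add fn_scale del: add_bit_eq_xor)
    show "super_skew fun_scale A om"
      unfolding super_skew_def om_def by (intro allI ballI fn_skew part_sub(1))
  next
    fix x y u d e assume x: "x \<in> A d" and y: "y \<in> A e" and u: "u \<in> carr H"
    note c = AG(3)[OF x] AG(3)[OF y] carr_sub(2)[OF u]
    have pa0: "pa (br g u) = 0" if "g \<in> carr G" for g
      using pa_br_perp(1)[OF that c(3) proj_id(3)[OF u]] .
    have l: "br x (br y u) = br (br x y) u + s (psign (d * e)) (br y (br x u))"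
      by (rule br_leibniz[OF AG(1)[OF x] AG(1)[OF y] c(3)])
    have "ph (br x (br y u)) = ph (br (br x y) u) + s (psign (d * e)) (ph (br y (br x u)))"
      unfolding l using c by (simp add: proj_add proj_scale br_carr carr_scale)
    \<comment> \<open>The \<open>A\<close>-component of \<open>br x y\<close> yields
      \<open>\<rho>\<close> of the bracket in \<open>A\<close>, the \<open>H\<close>-component
      yields the inner derivation by \<open>\<lambda>\<close>, and the \<open>J\<close>-component
      contributes only to \<open>J\<close>.\<close>
    moreover have "ph (br (br x y) u) = brh (bra x y) u + brh (brh x y) u"
      using ph_br(2)[OF c(3) br_carr[OF c(1,2)]] by (simp add: brh_def bra_def)
    ultimately show "(brh x (brh y u) - s (psign (d * e)) (brh y (brh x u))) - brh (bra x y) u =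
        brh (brh x y) u"
      using c by (simp add: brh_def[of x] brh_def[of y] ph_br_perp br_carr pa0)
  next
    fix x y z d e f assume xyz: "x \<in> A d" "y \<in> A e" "z \<in> A f"
    note G = xyz[THEN AG(1)] and c = xyz[THEN AG(3)] and cA = xyz[THEN AG(2)]
    have j: "cyclic_sum s d e f (\<lambda>x y z. br x (br y z)) x y z = 0" by (rule jacobi[OF G])
    have "brh x (brh y z) + brh x (bra y z) = ph (br x (br y z))"
      if "x \<in> carr G" "y \<in> carr G" "z \<in> carr G" for x y z
      using ph_br(1)[OF that(1) br_carr[OF that(2,3)]] by (simp add: brh_def bra_def add.commute)
    then have "cyclic_sum s d e f (\<lambda>x y z. brh x (brh y z) + brh x (bra y z)) x y z =
        cyclic_sum s d e f (\<lambda>x y z. ph (br x (br y z))) x y z"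
      using c by (simp add: cyclic_sum_def)
    also have "\<dots> = ph (cyclic_sum s d e f (\<lambda>x y z. br x (br y z)) x y z)"
      using c by (intro proj_cyclic_sum(2)[symmetric]) (simp_all add: br_carr)
    finally show "cyclic_sum s d e f (\<lambda>x y z. brh x (brh y z) + brh x (bra y z)) x y z = 0"
      by (simp add: j proj_zero)
    \<comment> \<open>The three summands come from the \<open>J\<close>-, \<open>A\<close>- and
      \<open>H\<close>-components of \<open>br y z\<close>, in this order.\<close>
    have "coad s \<delta> A bra x (om y z) + om x (bra y z) + chi A H B brh x (brh y z) = fn (br x (br y z))"
      if "x \<in> carr A" "y \<in> carr A" "z \<in> carr A" for x y z
    proof -
      note cG = that[THEN carr_sub(1)]
      note w = br_carr[OF cG(2,3)]
      have "fn (br x (br y z)) = fn (br x (pa (br y z))) + fn (br x (ph (br y z))) + fn (br x (pj (br y z)))"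
        using br_split_right[OF cG(1) w] proj_carrG[OF w] cG by (simp add: fn_add br_carr carr_add)
      then show ?thesis
        using coad_fn[OF that(1) w] chi_fn[OF that(1) proj_carr(2)[OF w]]
        by (simp add: om_def bra_def brh_def)
    qed
    then have "cyclic_sum fun_scale d e f (\<lambda>x y z. coad s \<delta> A bra x (om y z) + om x (bra y z) +
          chi A H B brh x (brh y z)) x y z = cyclic_sum fun_scale d e f (\<lambda>x y z. fn (br x (br y z))) x y z"
      using cA by (simp add: cyclic_sum_def)
    also have "\<dots> = fn (cyclic_sum s d e f (\<lambda>x y z. br x (br y z)) x y z)"
      using c by (intro fn_cyclic_sum[symmetric]) (simp_all add: br_carr)
    also have "\<dots> = 0" by (simp add: j fn_zero A.carr_zero)
    finally show "cyclic_sum fun_scale d e f (\<lambda>x y z. coad s \<delta> A bra x (om y z) + om x (bra y z) +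
          chi A H B brh x (brh y z)) x y z = 0" .
    \<comment> \<open>The cyclic condition is invariance,
      \<open>B (br x y) z = B x (br y z)\<close>, followed by super-symmetry.\<close>
    have "om x y z = B (br x y) z" "om y z x = B (br y z) x"
      using cA by (simp_all add: om_def fn_apply)
    then show "om x y z = psign ((e + f) * d) * om y z x"
      using form_invariant[OF c] form_supersymmetric[OF G(1) br_part[OF G(2,3)]]
      by (metis mult.commute)
  qed
qed

section \<open>The isometry onto the extension\<close>

lemma pj_id: "w \<in> carr J \<Longrightarrow> pj w = w"
  by (simp add: pj_def proj_id)

text \<open>The \<open>biext\<close> terms of \<open>gde_bracket\<close> encode brackets in the
  opposite order. Skew-symmetry in \<open>G\<close> absorbs their signs, which turns the subtracted
  term into an added component of \<open>br u y\<close>. The next two lemmas do the same for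
  \<open>\<chi>\<close> and the coadjoint action.\<close>

lemma biext_rho:
  assumes "u \<in> carr H" and "y \<in> carr A"
  shows "biext H A (\<lambda>d e u y. s (psign (d * e)) (brh y u)) u y = - ph (br u y)"
proof (rule biext_eq[OF H.super_space_axioms A.super_space_axioms assms])
  fix d e u y assume "u \<in> H d" "y \<in> A e"
  then show "s (psign (d * e)) (brh y u) = - ph (br u y)"
    using proj_skew(2)[OF part_sub(2) part_sub(1)] by (simp add: brh_def)
qed (simp_all add: carr_sub br_linear proj_add)

lemma biext_chi:
  assumes "u \<in> carr H" and "y \<in> carr A"
  shows "biext H A (\<lambda>d e u y. fun_scale (psign (d * e)) (chi A H B brh y u)) u y = - fn (br u y)"
proof (rule biext_eq[OF H.super_space_axioms A.super_space_axioms assms])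
  fix d e u y assume u: "u \<in> H d" and y: "y \<in> A e"
  show "fun_scale (psign (d * e)) (chi A H B brh y u) = - fn (br u y)"
    unfolding chi_fn[OF A.part_carr[OF y] H.part_carr[OF u]] fn_skew[OF part_sub(2)[OF u] part_sub(1)[OF y]]
    by simp
qed (simp_all only: carr_sub br_linear fn_add minus_add_distrib)

lemma biext_coad:
  assumes w: "w \<in> carr G" and y: "y \<in> carr A"
  shows "biext (pdual s \<delta> A) A (\<lambda>d e f y. fun_scale (psign (d * e)) (coad s \<delta> A bra y f)) (fn w) y =
    - fn (br (pj w) y)"
proof -
  have j: "pj w \<in> carr J" "pj w \<in> carr G" using proj_carr(3) proj_carrG(3) w by blast+
  have "hcomp (pdual s \<delta> A) e (fn w) = fn (hcomp J e (pj w))" for e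
    using hcomp_fn[OF j(2)] fn_pj[OF w] sub_super_space(3)[OF sub_J j(1)] by simp
  then have "biext (pdual s \<delta> A) A (\<lambda>d e f y. fun_scale (psign (d * e)) (coad s \<delta> A bra y f)) (fn w) y =
      biext J A (\<lambda>d e w y. fun_scale (psign (d * e)) (coad s \<delta> A bra y (fn w))) (pj w) y"
    unfolding biext_def by (simp only:)
  also have "\<dots> = - fn (br (pj w) y)"
  proof (rule biext_eq[OF J.super_space_axioms A.super_space_axioms j(1) y])
    fix d e w y assume w: "w \<in> J d" and y: "y \<in> A e"
    note wG = part_sub(3)[OF w]
    show "fun_scale (psign (d * e)) (coad s \<delta> A bra y (fn w)) = - fn (br w y)"
      unfolding coad_fn[OF A.part_carr[OF y] part_carr[OF wG]] fn_skew[OF wG part_sub(1)[OF y]]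
        pj_id[OF J.part_carr[OF w]] by simp
  qed (simp_all only: carr_sub br_linear fn_add minus_add_distrib)
  finally show ?thesis .
qed

lemma biext_pairing:
  assumes x: "x \<in> carr A" and w: "w \<in> carr G"
  shows "biext A (pdual s \<delta> A) (\<lambda>d e x g. psign (d * e) * g x) x (fn w) = B x w"
proof -
  have "biext A (pdual s \<delta> A) (\<lambda>d e x g. psign (d * e) * g x) x (fn w) =
      biext A G (\<lambda>d e x w. psign (d * e) * fn w x) x w"
    unfolding biext_def by (simp only: hcomp_fn[OF w])
  also have "\<dots> = B x w"
  proof (rule biext_eq[OF A.super_space_axioms super_space_axioms x w])
    fix d e x w assume x: "x \<in> A d" and w: "w \<in> G e"
    show "psign (d * e) * fn w x = B x w"
      using form_supersymmetric[OF part_sub(1)[OF x] w] fn_apply[OF A.part_carr[OF x]] by simp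
  qed (simp_all add: carr_sub form_add_left form_add_right)
  finally show ?thesis .
qed

definition phi where "phi x = (pa x, ph x, fn x)"

abbreviation gbr where "gbr \<equiv> gde_bracket s H brh B \<delta> s A bra brh brh om"

lemma phi_br:
  assumes x: "x \<in> carr G" and y: "y \<in> carr G"
  shows "phi (br x y) = gbr (phi x) (phi y)"
proof -
  note px = proj_carr[OF x] and py = proj_carr[OF y] and gx = proj_carrG[OF x] and gy = proj_carrG[OF y]
  have "pa (br x y) = bra (pa x) (pa y)"
    using pa_br(1)[OF gx(1) y] pa_br(2)[OF y x] by (simp add: bra_def)
  moreover have "ph (br x y) = brh (pa x) (pa y) + brh (pa x) (ph y)
      - biext H A (\<lambda>d e u y. s (psign (d * e)) (brh y u)) (ph x) (pa y) + brh (ph x) (ph y)"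
    using ph_br(2)[OF y x] ph_br(1)[OF gx(1) y] ph_br(1)[OF gx(2) y]
    unfolding biext_rho[OF px(2) py(1)] unfolding brh_def by (simp add: algebra_simps)
  moreover have "fn (br x y) = om (pa x) (pa y) + chi A H B brh (pa x) (ph y)
      - biext H A (\<lambda>d e u y. fun_scale (psign (d * e)) (chi A H B brh y u)) (ph x) (pa y)
      + Phi A H B brh (ph x) (ph y) + coad s \<delta> A bra (pa x) (fn y)
      - biext (pdual s \<delta> A) A (\<lambda>d e f y. fun_scale (psign (d * e)) (coad s \<delta> A bra y f)) (fn x) (pa y)"
  proof -
    \<comment> \<open>Of the nine brackets between components these three vanish; the remaining six
      match the six terms of the last coordinate of \<open>gde_bracket\<close>.\<close>
    have z: "br (ph x) (pj y) = 0" "br (pj x) (ph y) = 0" "br (pj x) (pj y) = 0"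
      using br_perp_J(1)[OF gx(2) _ py(3)] br_perp_J(2)[OF gy(2) _ px(3)] br_perp_J(1)[OF gx(3) _ py(3)]
        proj_id px py by blast+
    have "br x y = br (pa x) (pa y) + br (pa x) (ph y) + br (pa x) (pj y) + br (ph x) (pa y)
        + br (ph x) (ph y) + br (pj x) (pa y)"
      using br_split_left[OF y x] br_split_right[OF gx(1) y] br_split_right[OF gx(2) y]
        br_split_right[OF gx(3) y] z by (simp add: algebra_simps)
    then have "fn (br x y) = fn (br (pa x) (pa y)) + fn (br (pa x) (ph y)) + fn (br (pa x) (pj y))
        + fn (br (ph x) (pa y)) + fn (br (ph x) (ph y)) + fn (br (pj x) (pa y))"
      using gx gy by (simp only: fn_add br_carr carr_add)
    then show ?thesis
      unfolding biext_chi[OF px(2) py(1)] biext_coad[OF x py(1)] chi_fn[OF px(1) py(2)]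
        Phi_fn[OF px(2) py(2)] coad_fn[OF px(1) y] om_def by (simp only: diff_minus_eq_add ac_simps)
  qed
  ultimately show ?thesis unfolding phi_def gde_bracket_def by simp
qed

lemma phi_form:
  assumes x: "x \<in> carr G" and y: "y \<in> carr G"
  shows "gde_form B \<delta> s A (phi x) (phi y) = B x y"
  using form_eq[OF x y] biext_pairing[OF proj_carr(1)[OF x] y] proj_carr(1)[OF y]
  by (simp add: phi_def gde_form_def fn_apply)

lemma phi_add: "x \<in> carr G \<Longrightarrow> y \<in> carr G \<Longrightarrow> phi (x + y) = phi x + phi y"
  by (simp add: phi_def proj_add fn_add)

lemma phi_part: "x \<in> G d \<Longrightarrow> phi x \<in> gde_space s \<delta> A H d"
  by (simp add: phi_def gde_space_def proj_part fn_part)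

lemma phi_surj_part:
  assumes "q \<in> gde_space s \<delta> A H d"
  shows "\<exists>x\<in>carr G. phi x = q"
proof -
  obtain a u f where q: "q = (a, u, f)" "a \<in> A d" "u \<in> H d" "f \<in> pdual s \<delta> A d"
    using assms unfolding gde_space_def by auto
  obtain j where j: "j \<in> carr J" "fn j = f"
    using fn_surj q(4) unfolding pdual_iff by blast
  note c = A.part_carr[OF q(2)] H.part_carr[OF q(3)] j(1)
  note g = c(1)[THEN carr_sub(1)] c(2)[THEN carr_sub(2)] c(3)[THEN carr_sub(3)]
  have "fn (a + u + j) = f"
    using fn_zero c j g by (simp add: fn_add carr_add)
  then have "phi (a + u + j) = q"
    unfolding phi_def q(1) using proj_eq[OF c] by simp
  then show ?thesis using carr_add g by blast
qed

lemma phi_bij: "bij_betw phi (carr G) (carr (gde_space s \<delta> A H))"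
proof (rule bij_betw_imageI)
  show "inj_on phi (carr G)"
  proof (rule inj_onI)
    fix x y assume x: "x \<in> carr G" and y: "y \<in> carr G" and e: "phi x = phi y"
    \<comment> \<open>Injectivity comes for free: \<open>phi\<close> preserves the form and
      \<open>B\<close> is nondegenerate.\<close>
    have "B x z = B y z" if "z \<in> carr G" for z
      using phi_form[OF x that] phi_form[OF y that] e by simp
    then have "x - y = 0"
      using x y by (intro form_nondegenerate) (auto simp: carr_diff form_diff_left)
    then show "x = y" by simp
  qed
  show "phi ` carr G = carr (gde_space s \<delta> A H)"
  proof
    show "phi ` carr G \<subseteq> carr (gde_space s \<delta> A H)"
    proof
      fix q assume "q \<in> phi ` carr G"
      then obtain x where x: "x \<in> carr G" "q = phi x" by blast
      have "q = phi (hcomp G 0 x) + phi (hcomp G 1 x)"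
        using phi_add[OF hcomp_carr[OF x(1), of 0] hcomp_carr[OF x(1), of 1]] x by (simp add: hcomp_sum)
      then show "q \<in> carr (gde_space s \<delta> A H)"
        using phi_part[OF hcomp_part[OF x(1)]] unfolding carr_def by blast
    qed
    show "carr (gde_space s \<delta> A H) \<subseteq> phi ` carr G"
    proof
      fix q assume "q \<in> carr (gde_space s \<delta> A H)"
      then obtain q0 q1 where q: "q0 \<in> gde_space s \<delta> A H 0" "q1 \<in> gde_space s \<delta> A H 1" "q = q0 + q1"
        unfolding carr_def by blast
      obtain x y where "x \<in> carr G" "y \<in> carr G" "phi x = q0" "phi y = q1"
        using phi_surj_part[OF q(1)] phi_surj_part[OF q(2)] by blast
      then show "q \<in> phi ` carr G" using q(3) phi_add carr_add by (metis imageI)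
    qed
  qed
qed

theorem generalized_double_extension:
  "is_generalized_double_extension s G br B \<delta> s H brh B s A bra"
proof -
  have "linear_map_on s (gde_scale s s) (carr G) phi"
    unfolding linear_map_on_def
    by (simp add: phi_add) (simp add: phi_def gde_scale_def proj_scale fn_scale)
  then have "isometry s G br B (gde_scale s s) (gde_space s \<delta> A H) gbr (gde_form B \<delta> s A) phi"
    unfolding isometry_def using phi_bij phi_part phi_br phi_form by simp
  then show ?thesis
    unfolding is_generalized_double_extension_def using gde_context_om by blast
qed

end

section \<open>Existence of a Witt decomposition\<close>

context quadratic_lie_superalgebra
begin

lemma orthogonal_part_subspace:
  assumes "S \<subseteq> carr L"
  shows "subspace {x \<in> L d. \<forall>y\<in>S. B x y = 0}"
  using assms part_carr
  by (intro subspaceI)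
    (auto simp: subset_iff part_zero part_add part_scale form_zero_left form_add_left form_scale_left)

text \<open>A graded version of Witt's theorem. The bracket enters only through the stability of
  \<open>J\<close>, which is passed on to the locale. Complements are chosen in each degree
  separately, which makes every summand graded.\<close>

lemma exists_witt_decomposition:
  assumes two: "(2::'f) \<noteq> 0" and fin: "finite b" "span b = carr L"
    and J: "\<And>d. subspace (J d)" "\<And>d. J d \<subseteq> L d"
    and JJ: "\<And>x y. x \<in> carr J \<Longrightarrow> y \<in> carr J \<Longrightarrow> B x y = 0"
    and br_J: "\<And>x y. x \<in> carr L \<Longrightarrow> y \<in> carr J \<Longrightarrow> br x y \<in> carr J"
  shows "\<exists>A H. witt_decomposition s L br B \<delta> A H J"
proof -
  interpret J: super_space s J by (rule sub_super_space(1)[OF J])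
  note JL = subsetD[OF sub_super_space(2)[OF J]]
  note represents = form_represents_functional[OF _ fin(1), unfolded fin(2)]
  have nondeg_L: "x = 0" if "x \<in> carr L" "\<And>y. y \<in> carr L \<Longrightarrow> B x y = 0" for x
    using that by (intro form_nondegenerate) auto
  have represents_L: "\<exists>z\<in>carr L. \<forall>y\<in>carr L. B z y = f y" if "linear_map_on s (*) (carr L) f" for f
    by (rule represents[OF subspace_carr order_refl form_bilinear nondeg_L that]) auto
  define Jp where "Jp d = {x \<in> L d. \<forall>y\<in>carr J. B x y = 0}" for d
  have Jp: "subspace (Jp d)" for d
    unfolding Jp_def by (rule orthogonal_part_subspace) (use JL in blast)
  have J_Jp: "J d \<subseteq> Jp d" for d
    unfolding Jp_def using J(2)[of d] JJ J.part_carr by blast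
  have "\<exists>C q. subspace C \<and> C \<subseteq> Jp d \<and> (\<forall>x\<in>Jp d. x - q x \<in> J d \<and> q x \<in> C) \<and>
      (\<forall>x\<in>J d. q x = 0) \<and> (\<forall>x\<in>C. q x = x)" for d
    by (rule exists_complement[OF J(1) Jp J_Jp, of d]) metis
  then obtain H p where H: "\<And>d. subspace (H d)" "\<And>d. H d \<subseteq> Jp d"
    and p: "\<And>d x. x \<in> Jp d \<Longrightarrow> x - p d x \<in> J d" "\<And>d x. x \<in> Jp d \<Longrightarrow> p d x \<in> H d"
      "\<And>d x. x \<in> J d \<Longrightarrow> p d x = 0" "\<And>d x. x \<in> H d \<Longrightarrow> p d x = x"
    by metis
  have H_L: "H d \<subseteq> L d" for d using H(2)[of d] unfolding Jp_def by blast
  interpret H: super_space s H by (rule sub_super_space(1)[OF H(1) H_L])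
  note HL = subsetD[OF sub_super_space(2)[OF H(1) H_L]]
  have HJ: "B x y = 0" if "x \<in> carr H" "y \<in> carr J" for x y
    using that(1)
  proof (induction rule: H.carr_induct)
    case (part d x)
    then show ?case using H(2)[of d] that(2) unfolding Jp_def by blast
  qed (simp add: form_add_left HL JL that(2))
  have J_perp: "\<exists>u\<in>carr H. \<exists>j\<in>carr J. x = u + j"
    if x: "x \<in> carr L" and xJ: "\<And>y. y \<in> carr J \<Longrightarrow> B x y = 0" for x
  proof -
    have "B (hcomp L d x) y = 0" if "y \<in> carr J" for d y
      using that
    proof (induction rule: J.carr_induct)
      case (part e y)
      then show ?case using form_hcomp_left[OF x subsetD[OF J(2) part]] xJ J.part_carr by simp
    qed (simp add: form_add_right JL hcomp_carr x)
    then have "hcomp L d x \<in> Jp d" for d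
      unfolding Jp_def using hcomp_part[OF x] by blast
    note h = p(1,2)[OF this]
    have "x = (p 0 (hcomp L 0 x) + p 1 (hcomp L 1 x)) +
        ((hcomp L 0 x - p 0 (hcomp L 0 x)) + (hcomp L 1 x - p 1 (hcomp L 1 x)))"
      using hcomp_sum[OF x] by (simp add: algebra_simps)
    then show ?thesis
      using h H.part_carr J.part_carr H.carr_add J.carr_add by metis
  qed
  have H_J_zero: "x = 0" if xH: "x \<in> carr H" and xJ: "x \<in> carr J" for x
  proof -
    have "hcomp L d x = 0" for d
    proof -
      have "hcomp L d x \<in> H d" "hcomp L d x \<in> J d"
        using H.hcomp_part[OF xH, of d] J.hcomp_part[OF xJ, of d]
          sub_super_space(3)[OF H(1) H_L xH, of d] sub_super_space(3)[OF J xJ, of d] by simp_all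
      then show ?thesis using p(3)[of "hcomp L d x" d] p(4)[of "hcomp L d x" d] by simp
    qed
    then show ?thesis using hcomp_sum[OF HL[OF xH]] by simp
  qed
  \<comment> \<open>A nonzero \<open>x\<close> orthogonal to \<open>H\<close> would be orthogonal to
    \<open>H + J\<close>, the whole orthogonal space of \<open>J\<close>. A functional vanishing on
    \<open>J\<close> but not at \<open>x\<close> is represented by some \<open>w\<close> in that
    space, which contradicts \<open>B w x = 1\<close>.\<close>
  have nondeg_H: "x = 0" if x: "x \<in> carr H" and z: "\<And>y. y \<in> carr H \<Longrightarrow> B x y = 0" for x
  proof (rule ccontr)
    assume "x \<noteq> 0"
    then have "x \<notin> carr J" using H_J_zero x by blast
    then obtain f where f: "Vector_Spaces.linear s (*) f" "\<And>y. y \<in> carr J \<Longrightarrow> f y = 0" "f x = 1"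
      using separating_functional[OF J.subspace_carr] by metis
    interpret f: Vector_Spaces.linear s "(*)" f by (rule f(1))
    have "linear_map_on s (*) (carr L) f" unfolding linear_map_on_def by (simp add: f.add f.scale)
    then obtain w where w: "w \<in> carr L" "\<And>y. y \<in> carr L \<Longrightarrow> B w y = f y"
      using represents_L by blast
    obtain u j where uj: "u \<in> carr H" "j \<in> carr J" "w = u + j"
      using J_perp[OF w(1)] w(2) f(2) JL by metis
    have "B u x = 0"
      using form_sym_zero[OF H.super_space_axioms _ H_L HL[OF x] z uj(1)] HL by blast
    moreover have "B j x = 0"
      using form_sym_zero[OF J.super_space_axioms _ J(2) HL[OF x] HJ[OF x] uj(2)] JL by blast
    ultimately have "B w x = 0" using uj x by (simp add: form_add_left HL JL)
    then show False using w(2)[OF HL[OF x]] f(3) by simp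
  qed
  define K where "K d = {x \<in> L d. \<forall>y\<in>carr H. B x y = 0}" for d
  have K: "subspace (K d)" for d
    unfolding K_def by (rule orthogonal_part_subspace) (use HL in blast)
  have K_L: "K d \<subseteq> L d" for d unfolding K_def by blast
  interpret K: super_space s K by (rule sub_super_space(1)[OF K K_L])
  note KL = subsetD[OF sub_super_space(2)[OF K K_L]]
  have KH: "B x y = 0" if "x \<in> carr K" "y \<in> carr H" for x y
    using that(1)
  proof (induction rule: K.carr_induct)
    case (part d x)
    then show ?case using that(2) unfolding K_def by blast
  qed (simp add: form_add_left HL KL that(2))
  have JH: "B x y = 0" if "x \<in> carr J" "y \<in> carr H" for x y
    using form_sym_zero[OF J.super_space_axioms _ J(2) HL[OF that(2)] HJ[OF that(2)] that(1)] JL by blast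
  have J_K: "J d \<subseteq> K d" for d
    unfolding K_def using J(2)[of d] JH J.part_carr by blast
  have JK: "x \<in> carr K" if "x \<in> carr J" for x
    using that J_K[of 0] J_K[of 1] unfolding carr_def by blast
  \<comment> \<open>Orthogonal projection onto \<open>H\<close>, possible by
    \<open>nondeg_H\<close>; the component of degree \<open>d\<close> of the representing vector
    already suffices, as the rest does not pair as \<open>x\<close> does.\<close>
  have split_H: "\<exists>u\<in>H d. x - u \<in> K d" if x: "x \<in> L d" for x d
  proof -
    have fx: "linear_map_on s (*) (carr H) (B x)"
      using part_carr[OF x] HL by (simp add: linear_map_on_def form_add_right form_scale_right)
    have "bilinear_map_on s s (*) (carr H) (carr H) B"
      using HL by (simp add: bilinear_map_on_def linear_map_on_def form_add_left form_add_right
          form_scale_left form_scale_right)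
    then obtain u where u: "u \<in> carr H" "\<And>y. y \<in> carr H \<Longrightarrow> B u y = B x y"
      using represents[OF H.subspace_carr _ _ nondeg_H fx] HL by blast
    let ?u = "hcomp L d u"
    have uH: "?u \<in> H d"
      using H.hcomp_part[OF u(1), of d] sub_super_space(3)[OF H(1) H_L u(1), of d] by simp
    have uL: "?u \<in> carr L" using HL[OF H.part_carr[OF uH]] .
    have "B ?u y = B x y" if "y \<in> carr H" for y
      using that
    proof (induction rule: H.carr_induct)
      case (part e y)
      then show ?case
        using form_hcomp_left[OF HL[OF u(1)] subsetD[OF H_L part]] u(2)[OF H.part_carr[OF part]]
          form_degree[OF x subsetD[OF H_L part]] by simp
    qed (simp add: form_add_right HL uL part_carr[OF x])
    then have "x - ?u \<in> K d"
      unfolding K_def using x subsetD[OF H_L uH] uL HL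
      by (simp add: part_diff form_diff_left part_carr)
    then show ?thesis using uH by blast
  qed
  \<comment> \<open>A complement of \<open>J\<close> in \<open>K\<close> without any isotropy;
    \<open>B\<close> on it is corrected below.\<close>
  have "\<exists>C q. subspace C \<and> C \<subseteq> K d \<and> (\<forall>x\<in>K d. x - q x \<in> J d \<and> q x \<in> C) \<and>
      Vector_Spaces.linear s s q \<and> (\<forall>x\<in>J d. q x = 0) \<and> (\<forall>x\<in>C. q x = x)" for d
    by (rule exists_complement[OF J(1) K J_K, of d]) metis
  then obtain C q where C: "\<And>d. subspace (C d)" "\<And>d. C d \<subseteq> K d"
    and q: "\<And>d x. x \<in> K d \<Longrightarrow> x - q d x \<in> J d" "\<And>d x. x \<in> K d \<Longrightarrow> q d x \<in> C d"
      "\<And>d. Vector_Spaces.linear s s (q d)"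
      "\<And>d x. x \<in> J d \<Longrightarrow> q d x = 0" "\<And>d x. x \<in> C d \<Longrightarrow> q d x = x"
    by metis
  have q_add: "q d (x + y) = q d x + q d y" and q_scale: "q d (s c x) = s c (q d x)" for d x y c
    using q(3)[of d] by (simp_all add: Vector_Spaces.linear_def module_hom_iff)
  have C_L: "C d \<subseteq> L d" for d using C(2)[of d] K_L[of d] by blast
  interpret C: super_space s C by (rule sub_super_space(1)[OF C(1) C_L])
  note CL = subsetD[OF sub_super_space(2)[OF C(1) C_L]]
  have CK: "x \<in> carr K" if "x \<in> carr C" for x
    using that C(2)[of 0] C(2)[of 1] unfolding carr_def by blast
  have carr_L: "\<exists>u\<in>carr H. \<exists>k\<in>carr K. x = u + k" if "x \<in> carr L" for x
    using that
  proof (induction rule: carr_induct)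
    case (part d x)
    obtain u where "u \<in> H d" "x - u \<in> K d" using split_H[OF part] by blast
    then have "u \<in> carr H" "x - u \<in> carr K" "x = u + (x - u)" using H.part_carr K.part_carr by auto
    then show ?case by blast
  next
    case (add x y)
    then obtain u k u' k' where "u \<in> carr H" "k \<in> carr K" "x = u + k" "u' \<in> carr H" "k' \<in> carr K"
      "y = u' + k'" by blast
    moreover have "u + k + (u' + k') = (u + u') + (k + k')" by (simp add: algebra_simps)
    ultimately show ?case using H.carr_add K.carr_add by metis
  qed
  have HK: "B x y = 0" if "x \<in> carr H" "y \<in> carr K" for x y
    using form_sym_zero[OF H.super_space_axioms _ H_L KL[OF that(2)] KH[OF that(2)] that(1)] HL by blast
  have nondeg_K: "x = 0" if x: "x \<in> carr K" and z: "\<And>y. y \<in> carr K \<Longrightarrow> B x y = 0" for x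
  proof (rule form_nondegenerate[OF KL[OF x]], rule ballI)
    fix y assume "y \<in> carr L"
    then obtain u k where "u \<in> carr H" "k \<in> carr K" "y = u + k" using carr_L by blast
    then show "B x y = 0" using z KH x by (simp add: form_add_right HL KL)
  qed
  \<comment> \<open>The projections of the two degrees glued into one map, additive on all of
    \<open>carr L\<close> and on \<open>carr K\<close> the projection onto \<open>C\<close> along
    \<open>J\<close>.\<close>
  define Q where "Q x = q 0 (hcomp L 0 x) + q 1 (hcomp L 1 x)" for x
  have hcomp_K: "hcomp L d x \<in> K d" if "x \<in> carr K" for x d
    using K.hcomp_part[OF that] sub_super_space(3)[OF K K_L that] by simp
  have q_zero: "q d 0 = 0" for d using q(4) J.part_zero by blast
  have Q_part: "Q x = q d x" if "x \<in> K d" for x d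
    using that subsetD[OF K_L that] bit_cases[of d]
    by (auto simp: Q_def hcomp_homogeneous[of x d] q_zero)
  have Q_carr: "Q x \<in> carr C" "x - Q x \<in> carr J" if "x \<in> carr K" for x
  proof -
    note h = hcomp_K[OF that]
    show "Q x \<in> carr C"
      unfolding Q_def using q(2)[OF h] C.part_carr C.carr_add by blast
    have "x - Q x = (hcomp L 0 x - q 0 (hcomp L 0 x)) + (hcomp L 1 x - q 1 (hcomp L 1 x))"
      using hcomp_sum[OF KL[OF that]] by (simp add: Q_def algebra_simps)
    then show "x - Q x \<in> carr J" using q(1)[OF h] J.part_carr J.carr_add by metis
  qed
  have Q_add: "Q (x + y) = Q x + Q y" if "x \<in> carr L" "y \<in> carr L" for x y
    using that by (simp add: Q_def hcomp_add q_add)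
  have Q_J: "Q x = 0" if "x \<in> carr J" for x
    using that
  proof (induction rule: J.carr_induct)
    case (part d x)
    then show ?case using q(4) Q_part J_K by fastforce
  qed (simp add: Q_add JL)
  have Q_C: "Q x = x" if "x \<in> carr C" for x
    using that
  proof (induction rule: C.carr_induct)
    case (part d x)
    then show ?case using q(5)[OF part] Q_part[OF subsetD[OF C(2) part]] by simp
  qed (simp add: Q_add CL)
  have Q_scale: "Q (s c x) = s c (Q x)" if "x \<in> carr L" for x c
    using that
  proof (induction rule: carr_induct)
    case (part d x)
    then show ?case
      using part_scale[OF part, of c] bit_cases[of d]
      by (auto simp: Q_def hcomp_homogeneous[of x d] hcomp_homogeneous[of "s c x" d] q_zero q_scale)
  next
    case (add x y)
    then show ?case by (simp add: Q_add scale_right_distrib carr_scale)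
  qed
  \<comment> \<open>The functional vanishes on \<open>J\<close>, so its representative
    \<open>z\<close> in \<open>K\<close> lies in \<open>H + J\<close>. It is also orthogonal to
    \<open>H\<close>, so \<open>nondeg_H\<close> removes the \<open>H\<close>-component: within
    \<open>K\<close>, \<open>J\<close> is its own orthogonal space.\<close>
  have represents_C: "\<exists>j\<in>J d. \<forall>y\<in>carr C. B j y = c * B x y" if x: "x \<in> C d" for x d c
  proof -
    note xL = CL[OF C.part_carr[OF x]]
    have fx: "linear_map_on s (*) (carr K) (\<lambda>y. c * B x (Q y))"
      using xL KL CL Q_carr
      by (simp add: linear_map_on_def Q_add Q_scale form_add_right form_scale_right algebra_simps)
    have "bilinear_map_on s s (*) (carr K) (carr K) B"
      using KL by (simp add: bilinear_map_on_def linear_map_on_def form_add_left form_add_right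
          form_scale_left form_scale_right)
    then obtain z where z: "z \<in> carr K" "\<And>y. y \<in> carr K \<Longrightarrow> B z y = c * B x (Q y)"
      using represents[OF K.subspace_carr _ _ nondeg_K fx] KL by blast
    have "B z y = 0" if "y \<in> carr J" for y
      using z(2)[OF JK[OF that]] Q_J[OF that] xL by (simp add: form_zero_right)
    then obtain u j where uj: "u \<in> carr H" "j \<in> carr J" "z = u + j"
      using J_perp[OF KL[OF z(1)]] by blast
    have "B u y = 0" if "y \<in> carr H" for y
      using KH[OF z(1) that] JH[OF uj(2) that] uj that by (simp add: form_add_left HL JL)
    then have zJ: "z \<in> carr J" using nondeg_H[OF uj(1)] uj by simp
    let ?z = "hcomp L d z"
    have zd: "?z \<in> J d"
      using J.hcomp_part[OF zJ, of d] sub_super_space(3)[OF J zJ, of d] by simp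
    have "B ?z y = c * B x y" if "y \<in> carr C" for y
      using that
    proof (induction rule: C.carr_induct)
      case (part e y)
      note yL = subsetD[OF C_L part] and yc = C.part_carr[OF part]
      show ?case
        using form_hcomp_left[OF KL[OF z(1)] yL] z(2)[OF CK[OF yc]] Q_C[OF yc]
          form_degree[OF subsetD[OF C_L x] yL] by simp
    next
      case (add y y')
      then show ?case
        using JL[OF J.part_carr[OF zd]] xL by (simp add: form_add_right CL algebra_simps)
    qed
    then show ?thesis using zd by blast
  qed
  \<comment> \<open>The property of \<open>j\<close> transferred to the other argument:
    \<open>j\<close> and \<open>y\<close> have the same degree, so super-symmetry gives both sides
    the same sign.\<close>
  have JC: "B x j = - (1/2) * B x y"
    if "x \<in> C d" "j \<in> J e" "y \<in> C e" and jy: "\<And>x. x \<in> carr C \<Longrightarrow> B j x = - (1/2) * B y x" for x j y d e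
    using form_supersymmetric[OF subsetD[OF C_L that(1)] subsetD[OF J(2) that(2)]]
      form_supersymmetric[OF subsetD[OF C_L that(1)] subsetD[OF C_L that(3)]]
      jy[OF C.part_carr[OF that(1)]] by simp
  txt \<open>
    With \<open>\<theta>\<close> from \<open>C\<close> to \<open>J\<close> determined by \<open>B (\<theta> x) y = B x y\<close>, this is the image of \<open>C\<close> under
    \<open>x \<mapsto> x - \<theta> x / 2\<close>. Described in this way, it is visibly a subspace.
  \<close>
  define A where "A d = {w \<in> K d. \<forall>y\<in>carr C. B (w - Q w) y = - (1/2) * B (Q w) y}" for d
  have A_K: "A d \<subseteq> K d" and A_L: "A d \<subseteq> L d" for d
    unfolding A_def using K_L by blast+
  have KcL: "w \<in> carr L" "Q w \<in> carr L" "w - Q w \<in> carr L" if "w \<in> K d" for w d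
    using KL CL JL Q_carr K.part_carr[OF that] by blast+
  have A: "subspace (A d)" for d
  proof (rule subspaceI)
    show "0 \<in> A d"
      unfolding A_def using K.part_zero Q_J[OF J.carr_zero] CL by (simp add: form_zero_left)
    fix x y c assume x: "x \<in> A d" and y: "y \<in> A d"
    note k = KcL[OF subsetD[OF A_K x]] KcL[OF subsetD[OF A_K y]]
    have xy: "x + y - Q (x + y) = (x - Q x) + (y - Q y)" using k by (simp add: Q_add)
    have "B (x + y - Q (x + y)) z = - (1/2) * B (Q (x + y)) z" if z: "z \<in> carr C" for z
    proof -
      have "B (x + y - Q (x + y)) z = B (x - Q x) z + B (y - Q y) z"
        unfolding xy by (rule form_add_left[OF k(3,6) CL[OF z]])
      also have "\<dots> = - (1/2) * (B (Q x) z + B (Q y) z)"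
        using x y z unfolding A_def by (simp add: algebra_simps)
      also have "B (Q x) z + B (Q y) z = B (Q (x + y)) z"
        using form_add_left[OF k(2,5) CL[OF z]] k by (simp add: Q_add)
      finally show ?thesis .
    qed
    then show "x + y \<in> A d" using x y K.part_add unfolding A_def by blast
    have cx: "s c x - Q (s c x) = s c (x - Q x)" using k by (simp add: Q_scale scale_right_diff_distrib)
    have "B (s c x - Q (s c x)) z = - (1/2) * B (Q (s c x)) z" if z: "z \<in> carr C" for z
      unfolding cx using x z k CL[OF z] unfolding A_def
      by (simp only: form_scale_left Q_scale) simp
    then show "s c x \<in> A d" using x K.part_scale unfolding A_def by blast
  qed
  have split_K: "\<exists>w\<in>A d. x - w \<in> J d" if x: "x \<in> K d" for x d
  proof -
    have qx: "q d x \<in> C d" using q(2)[OF x] .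
    \<comment> \<open>\<open>j\<close> is minus half of the image of \<open>q d x\<close> under
      \<open>\<theta>\<close>, that is, \<open>represents_C\<close> with
      \<open>c = - (1/2)\<close>.\<close>
    obtain j where j: "j \<in> J d" "\<forall>y\<in>carr C. B j y = - (1/2) * B (q d x) y"
      using represents_C[OF qx] by blast
    let ?w = "q d x + j"
    have wK: "?w \<in> K d" using K.part_add subsetD[OF C(2) qx] subsetD[OF J_K j(1)] by blast
    have "Q ?w = q d x"
      using Q_add[OF CL[OF C.part_carr[OF qx]] JL[OF J.part_carr[OF j(1)]]]
        Q_C[OF C.part_carr[OF qx]] Q_J[OF J.part_carr[OF j(1)]] by simp
    then have "?w \<in> A d" unfolding A_def using wK j(2) by simp
    moreover have "x - ?w \<in> J d" using J.part_diff[OF q(1)[OF x] j(1)] by (simp add: algebra_simps)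
    ultimately show ?thesis by blast
  qed
  interpret A: super_space s A by (rule sub_super_space(1)[OF A A_L])
  note AL = subsetD[OF sub_super_space(2)[OF A A_L]]
  have AA_part: "B w w' = 0" if w: "w \<in> A d" and w': "w' \<in> A e" for w w' d e
  proof -
    have wK: "w \<in> K d" "w' \<in> K e" using w w' unfolding A_def by blast+
    note c = KcL[OF wK(1)] KcL[OF wK(2)]
    have qC: "Q w \<in> C d" "Q w' \<in> C e" "w - Q w \<in> J d" "w' - Q w' \<in> J e"
      using Q_part wK q(1,2) by simp_all
    \<comment> \<open>The origin of the constant: each of the two cross terms contributes minus half
      of \<open>B (Q w) (Q w')\<close> and the term inside \<open>J\<close> is zero, leaving
      \<open>1 - 1/2 - 1/2\<close> times this value.\<close>
    have 1: "B (w - Q w) (Q w') = - (1/2) * B (Q w) (Q w')"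
      using w C.part_carr[OF qC(2)] unfolding A_def by blast
    have 2: "B (Q w) (w' - Q w') = - (1/2) * B (Q w) (Q w')"
      using w' by (intro JC[OF qC(1,4,2)]) (simp add: A_def)
    have 3: "B (w - Q w) (w' - Q w') = 0" using JJ J.part_carr qC(3,4) by blast
    have "B (Q w + (w - Q w)) (Q w' + (w' - Q w')) =
        B (Q w) (Q w') + B (Q w) (w' - Q w') + (B (w - Q w) (Q w') + B (w - Q w) (w' - Q w'))"
      using c by (simp only: form_add_left form_add_right carr_add ac_simps)
    moreover have "Q v + (v - Q v) = v" for v by simp
    moreover have "c + - h * c + (- h * c + 0) = c - (h + h) * c" for c h :: 'f
      by (simp add: algebra_simps)
    ultimately have "B w w' = B (Q w) (Q w') - (1/2 + 1/2) * B (Q w) (Q w')"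
      unfolding 1 2 3 by (simp only:)
    also have "(1/2 + 1/2 :: 'f) = 1" using two by (simp flip: add_divide_distrib)
    finally show ?thesis by simp
  qed
  have "witt_decomposition s L br B \<delta> A H J"
  proof
    show "\<exists>a\<in>A d. \<exists>u\<in>H d. \<exists>j\<in>J d. x = a + u + j" if x: "x \<in> L d" for x d
    proof -
      obtain u where u: "u \<in> H d" "x - u \<in> K d" using split_H[OF x] by blast
      obtain w where w: "w \<in> A d" "x - u - w \<in> J d" using split_K[OF u(2)] by blast
      have "x = w + u + (x - u - w)" by simp
      then show ?thesis using u(1) w by blast
    qed
    show "B x y = 0" if x: "x \<in> carr A" and y: "y \<in> carr A" for x y
      using x
    proof (induction rule: A.carr_induct)
      case (part d x)
      note x = part
      from y show ?case
        by (induction rule: A.carr_induct)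
          (simp_all add: AA_part[OF x] form_add_right AL A.part_carr[OF x])
    qed (simp add: form_add_left AL y)
    show "B x y = 0" if "x \<in> carr A" "y \<in> carr H" for x y
      using KH[OF _ that(2)] that(1) A_K[of 0] A_K[of 1] unfolding carr_def by blast
    show "\<exists>z\<in>carr L. \<forall>y\<in>carr L. B z y = f y" if "linear_map_on s (*) (carr L) f" for f
      using represents_L[OF that] .
  qed (fact A A_L H(1) H_L J HJ JJ br_J)+
  then show ?thesis by blast
qed

section \<open>From non-simplicity to an isotropic ideal\<close>

lemma ideal_hcomp:
  assumes I: "lie_ideal s L br I" and x: "x \<in> I"
  shows "hcomp L d x \<in> I"
proof -
  have xL: "x \<in> carr L" using assms unfolding lie_ideal_def graded_subspace_def by blast
  have "hcomp L 0 x + hcomp L 1 x \<in> I" by (simp add: hcomp_sum xL x)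
  then have "hcomp L 0 x \<in> I \<and> hcomp L 1 x \<in> I"
    using I hcomp_part[OF xL] unfolding lie_ideal_def graded_subspace_def by blast
  then show ?thesis using bit_cases[of d] by auto
qed

text \<open>\<open>simple_lie\<close> demands a nonzero bracket, so non-simplicity yields an ideal
  only if the bracket does not vanish. Otherwise every graded subspace is an ideal, and the line
  through a homogeneous vector is proper by the dimension bound.\<close>

lemma exists_proper_ideal:
  assumes "\<not> simple_lie s L br" and "dim (carr L) > 1"
  shows "\<exists>I. lie_ideal s L br I \<and> I \<noteq> {0} \<and> I \<noteq> carr L"
proof (cases "\<exists>x\<in>carr L. \<exists>y\<in>carr L. br x y \<noteq> 0")
  case True
  then show ?thesis using assms(1) unfolding simple_lie_def by blast
next
  case False
  have "carr L \<noteq> {0}" using assms(2) dim_le_card[of "{0}" "{}"] by auto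
  then obtain y where y: "y \<in> carr L" "y \<noteq> 0" using carr_zero by blast
  then have "hcomp L 0 y \<noteq> 0 \<or> hcomp L 1 y \<noteq> 0" using hcomp_sum[OF y(1)] by auto
  then obtain x d where x: "x \<in> L d" "x \<noteq> 0" using hcomp_part[OF y(1)] by blast
  have sp: "span {x} \<subseteq> L d" using x(1) subspace_part by (intro span_minimal) auto
  have homog: "a \<in> span {x} \<and> b \<in> span {x}"
    if a: "a \<in> L 0" and b: "b \<in> L 1" and ab: "a + b \<in> span {x}" for a b
  proof (cases "d = 0")
    case True
    then have "(a + b) - a \<in> L 0" using sp a ab part_diff by blast
    then have "b = 0" using b parts_zero[of b 0] by simp
    then show ?thesis using ab span_zero by simp
  next
    case False
    then have "(a + b) - b \<in> L 1" using sp b ab part_diff bit_cases[of d] by blast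
    then have "a = 0" using a parts_zero[of a 0] by simp
    then show ?thesis using ab span_zero by simp
  qed
  have "lie_ideal s L br (span {x})"
    unfolding lie_ideal_def graded_subspace_def
  proof (intro conjI ballI impI)
    show "span {x} \<subseteq> carr L" using sp part_carr by blast
    show "br z y \<in> span {x}" if "z \<in> carr L" "y \<in> span {x}" for z y
      using False that sp part_carr span_zero by (metis subsetD)
    fix a b assume "a \<in> L 0" "b \<in> L 1" "a + b \<in> span {x}"
    then show "a \<in> span {x}" "b \<in> span {x}" using homog by blast+
  qed simp
  moreover have "span {x} \<noteq> {0}" using x(2) span_base[of x "{x}"] by auto
  moreover have "dim (span {x}) \<le> 1" using dim_le_card'[of "{x}"] by simp
  then have "span {x} \<noteq> carr L" using assms(2) by (metis linorder_not_le)
  ultimately show ?thesis by blast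
qed

text \<open>If \<open>I\<close> met its orthogonal space trivially, \<open>B\<close> would be
  nondegenerate on \<open>I\<close>, every \<open>B x\<close> on \<open>I\<close> would be
  represented in \<open>I\<close>, and orthogonal projection would decompose the algebra.\<close>

lemma exists_isotropic_ideal:
  assumes fin: "finite b" "span b = carr L" and indec: "\<not> decomposable s L br B"
    and I: "lie_ideal s L br I" "I \<noteq> {0}" "I \<noteq> carr L"
  shows "\<exists>J. (\<forall>d. subspace (J d) \<and> J d \<subseteq> L d) \<and> carr J \<noteq> {0} \<and>
    (\<forall>x\<in>carr J. \<forall>y\<in>carr J. B x y = 0) \<and> (\<forall>x\<in>carr L. \<forall>y\<in>carr J. br x y \<in> carr J)"
proof -
  have sub: "subspace I" and IL: "I \<subseteq> carr L"
    and brI: "\<And>x y. x \<in> carr L \<Longrightarrow> y \<in> I \<Longrightarrow> br x y \<in> I"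
    using I(1) unfolding lie_ideal_def graded_subspace_def by blast+
  have "I \<inter> orthogonal_space L B I \<noteq> {0}"
  proof
    assume z: "I \<inter> orthogonal_space L B I = {0}"
    have nondeg: "x = 0" if "x \<in> I" "\<And>y. y \<in> I \<Longrightarrow> B x y = 0" for x
      using that z IL unfolding orthogonal_space_def by blast
    have bil: "bilinear_map_on s s (*) I I B"
      using form_bilinear IL unfolding bilinear_map_on_def linear_map_on_def by blast
    have "\<exists>i\<in>I. x - i \<in> orthogonal_space L B I" if x: "x \<in> carr L" for x
    proof -
      have "linear_map_on s (*) I (B x)"
        using x IL by (simp add: linear_map_on_def form_add_right form_scale_right subset_iff)
      then obtain i where "i \<in> I" "\<And>y. y \<in> I \<Longrightarrow> B i y = B x y"
        using form_represents_functional[OF sub fin(1) _ bil nondeg] IL fin(2) by blast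
      then show ?thesis
        using x IL unfolding orthogonal_space_def
        by (intro bexI[of _ i]) (auto simp: form_diff_left carr_diff subset_iff)
    qed
    then have "carr L \<subseteq> {x + y | x y. x \<in> I \<and> y \<in> orthogonal_space L B I}"
    proof (intro subsetI)
      fix x assume "x \<in> carr L"
      then obtain i where "i \<in> I" "x - i \<in> orthogonal_space L B I"
        using \<open>\<And>x. x \<in> carr L \<Longrightarrow> \<exists>i\<in>I. x - i \<in> orthogonal_space L B I\<close> by blast
      moreover have "x = i + (x - i)" by simp
      ultimately show "x \<in> {x + y | x y. x \<in> I \<and> y \<in> orthogonal_space L B I}" by blast
    qed
    moreover have "{x + y | x y. x \<in> I \<and> y \<in> orthogonal_space L B I} \<subseteq> carr L"
      using IL carr_add unfolding orthogonal_space_def by blast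
    ultimately show False using indec I z unfolding decomposable_def by blast
  qed
  moreover have "0 \<in> I \<inter> orthogonal_space L B I"
    using sub IL unfolding orthogonal_space_def
    by (auto simp: subspace_0 carr_zero form_zero_left)
  ultimately obtain x where x: "x \<in> I" "x \<noteq> 0" "\<And>y. y \<in> I \<Longrightarrow> B x y = 0"
    unfolding orthogonal_space_def by blast
  have xL: "x \<in> carr L" using x(1) IL by blast
  \<comment> \<open>The homogeneous parts of the intersection, in the degreewise form that the Witt
    decomposition takes as input.\<close>
  define J where "J d = {x \<in> L d. x \<in> I \<and> (\<forall>y\<in>I. B x y = 0)}" for d
  have JI: "J d = I \<inter> {x \<in> L d. \<forall>y\<in>I. B x y = 0}" for d
    unfolding J_def by blast
  have J: "subspace (J d)" for d
    unfolding JI by (intro subspace_inter sub orthogonal_part_subspace IL)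
  have J_L: "J d \<subseteq> L d" for d unfolding J_def by blast
  interpret J: super_space s J by (rule sub_super_space(1)[OF J J_L])
  note JL = subsetD[OF sub_super_space(2)[OF J J_L]]
  have J_I: "y \<in> I" if "y \<in> carr J" for y
    using that by (induction rule: J.carr_induct) (auto simp: J_def subspace_add sub)
  have J_perp: "B y z = 0" if "y \<in> carr J" "z \<in> I" for y z
    using that(1)
  proof (induction rule: J.carr_induct)
    case (part d y)
    then show ?case using that(2) unfolding J_def by blast
  qed (simp add: form_add_left JL subsetD[OF IL that(2)])
  show ?thesis
  proof (intro exI[of _ J] conjI allI ballI)
    show "subspace (J d)" "J d \<subseteq> L d" for d by (fact J J_L)+
    show "B y z = 0" if "y \<in> carr J" "z \<in> carr J" for y z using J_perp J_I that by blast
    \<comment> \<open>The vector \<open>x\<close> found above need not be homogeneous. Because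
      \<open>I\<close> is graded, the components of \<open>x\<close> lie in \<open>I\<close> and are
      again orthogonal to \<open>I\<close>, and one of them is nonzero.\<close>
    show "carr J \<noteq> {0}"
    proof
      assume z: "carr J = {0}"
      have "hcomp L d x \<in> J d" for d
      proof -
        have "B (hcomp L d x) y = 0" if "y \<in> I" for y
        proof -
          have yc: "hcomp L e y \<in> I" for e using ideal_hcomp[OF I(1) that] .
          have yL: "y \<in> carr L" using that IL by blast
          have h: "B (hcomp L d x) (hcomp L e y) = 0" for e
            using form_hcomp_left[OF xL hcomp_part[OF yL, of e], of d] x(3)[OF yc] by simp
          have "B (hcomp L d x) (hcomp L 0 y + hcomp L 1 y) = 0"
            using h hcomp_carr[OF xL] hcomp_carr[OF yL] by (simp add: form_add_right)
          then show ?thesis by (simp add: hcomp_sum yL)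
        qed
        then show ?thesis
          unfolding J_def using hcomp_part[OF xL] ideal_hcomp[OF I(1) x(1)] by blast
      qed
      then have "hcomp L d x = 0" for d using z J.part_carr by blast
      then show False using hcomp_sum[OF xL] x(2) by simp
    qed
    show "br y z \<in> carr J" if y: "y \<in> carr L" and z: "z \<in> carr J" for y z
      using z
    proof (induction rule: J.carr_induct)
      case (part e z)
      note zL = subsetD[OF J_L part] and zc = J.part_carr[OF part]
      from y show ?case
      proof (induction rule: carr_induct)
        case (part d y)
        note c = part_carr[OF part] JL[OF zc]
        \<comment> \<open>The bracket is reversed first so that invariance moves \<open>y\<close>
          onto \<open>w\<close>, where the ideal property of \<open>I\<close> applies.\<close>
        have "B (br y z) w = 0" if w: "w \<in> I" for w
        proof -
          have wL: "w \<in> carr L" using w IL by blast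
          have "br y z = s (- psign (d * e)) (br z y)" using br_skew[OF part zL] by simp
          also have "B \<dots> w = - psign (d * e) * B (br z y) w"
            by (rule form_scale_left[OF br_carr[OF c(2,1)] wL])
          also have "B (br z y) w = B z (br y w)" using form_invariant[OF c(2,1) wL] .
          also have "\<dots> = 0" using J_perp[OF zc brI[OF c(1) w]] .
          finally show ?thesis by simp
        qed
        then have "br y z \<in> J (d + e)"
          unfolding J_def using br_part[OF part zL] brI[OF c(1) J_I[OF zc]] by blast
        then show ?case by (rule J.part_carr)
      qed (simp add: br_add_left JL[OF zc] J.carr_add)
    qed (simp add: br_add_right JL y J.carr_add)
  qed
qed

end

text \<open>\<open>J\<close> pairs only with \<open>A\<close>, so without \<open>A\<close> it would
  lie in the radical. This keeps the result from being the trivial extension of an algebra by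
  zero.\<close>

lemma (in witt_decomposition) carr_A_nonzero:
  assumes "carr J \<noteq> {0}"
  shows "carr A \<noteq> {0}"
proof
  assume z: "carr A = {0}"
  obtain j where j: "j \<in> carr J" "j \<noteq> 0" using assms J.carr_zero by blast
  have "B j y = 0" if "y \<in> carr G" for y
    using form_proj(6)[OF that j(1)] proj_carr(1)[OF that] z form_zero_right[OF carr_sub(3)[OF j(1)]]
    by simp
  then show False using form_nondegenerate[OF carr_sub(3)[OF j(1)]] j(2) by blast
qed

theorem corollary3p9:
  fixes s :: "'f::{alg_closed_field, field_char_0} \<Rightarrow> 'v::ab_group_add \<Rightarrow> 'v"
    and G :: "bit \<Rightarrow> 'v set" and br :: "'v \<Rightarrow> 'v \<Rightarrow> 'v" and B :: "'v \<Rightarrow> 'v \<Rightarrow> 'f" and \<delta> :: bit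
  assumes "quadratic_lie_superalgebra s G br B \<delta>"
    and "\<exists>b. finite b \<and> module.span s b = carr G"
    and "\<not> decomposable s G br B"
    and "\<not> simple_lie s G br"
    and "vector_space.dim s (carr G) > 1"
  shows "\<exists>H brh Bh A bra.
    quadratic_lie_superalgebra s H brh Bh \<delta> \<and> lie_superalgebra s A bra \<and> carr A \<noteq> {0} \<and>
    is_generalized_double_extension s G br B \<delta> s H brh Bh s A bra"
proof -
  interpret quadratic_lie_superalgebra s G br B \<delta> by fact
  obtain b where b: "finite b" "span b = carr G" using assms(2) by blast
  obtain I where I: "lie_ideal s G br I" "I \<noteq> {0}" "I \<noteq> carr G"
    using exists_proper_ideal[OF assms(4,5)] by blast
  obtain J where J: "\<And>d. subspace (J d)" "\<And>d. J d \<subseteq> G d" "carr J \<noteq> {0}"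
    "\<And>x y. x \<in> carr J \<Longrightarrow> y \<in> carr J \<Longrightarrow> B x y = 0"
    "\<And>x y. x \<in> carr G \<Longrightarrow> y \<in> carr J \<Longrightarrow> br x y \<in> carr J"
    using exists_isotropic_ideal[OF b assms(3) I] by blast
  \<comment> \<open>The premise left open is \<open>2 \<noteq> 0\<close>, which characteristic zero
    provides.\<close>
  obtain A H where "witt_decomposition s G br B \<delta> A H J"
    using exists_witt_decomposition[OF _ b J(1,2,4,5)] by auto
  then interpret witt_decomposition s G br B \<delta> A H J .
  show ?thesis
    using quadratic_H lie_A carr_A_nonzero[OF J(3)] generalized_double_extension by blast
qed

end
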